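(* There is a polynomial time $4$-approximation algorithm for OR-scheduling when the precedence DAG is an inforest.
   Context: OR-scheduling: given a set $N$ of jobs, each with processing time $p_j\ge0$ and weight $w_j\ge0$, and a DAG $G=(N,E)$ where $(i,j)\in E$ means $i$ is an OR-predecessor of $j$. Jobs are processed non-preemptively on a single machine, one at a time. A job $j$ with at least one predecessor may start only after at least one of its predecessors $\{i:(i,j)\in E\}$ has completed; jobs without predecessors may be scheduled at any time. The objective is to minimize $\sum_j w_jC_j$, where $C_j$ is the completion time of job $j$. An intree is a (weakly) connected DAG in which every vertex has at most one successor; an inforest is a DAG whose connected components are intrees. A $4$-approximation algorithm returns a feasible schedule with objective at most $4$ times the optimum. *)

theory Defs
  imports Complex_Main "HOL-Library.Log_Nat" "HOL-Computational_Algebra.Polynomial"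
begin

section \<open>Precedence graphs\<close>

definition dag :: "'a set \<Rightarrow> ('a \<times> 'a) set \<Rightarrow> bool" where
  "dag V E \<longleftrightarrow> finite V \<and> E \<subseteq> V \<times> V \<and> acyclic E"

definition weakly_linked :: "'a set \<Rightarrow> ('a \<times> 'a) set \<Rightarrow> ('a \<times> 'a) set" where
  "weakly_linked V E = {(u, v). u \<in> V \<and> v \<in> V \<and> (u, v) \<in> (E \<union> E\<inverse>)\<^sup>*}"

definition weakly_connected :: "'a set \<Rightarrow> ('a \<times> 'a) set \<Rightarrow> bool" where
  "weakly_connected V E \<longleftrightarrow> (\<forall>u\<in>V. \<forall>v\<in>V. (u, v) \<in> weakly_linked V E)"

definition intree :: "'a set \<Rightarrow> ('a \<times> 'a) set \<Rightarrow> bool" where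
  "intree V E \<longleftrightarrow> dag V E \<and> weakly_connected V E \<and> single_valued E"

text \<open>The connected components are the induced subgraphs on the classes of
  weak connectivity.\<close>

definition inforest :: "'a set \<Rightarrow> ('a \<times> 'a) set \<Rightarrow> bool" where
  "inforest V E \<longleftrightarrow> dag V E \<and> (\<forall>K \<in> V // weakly_linked V E. intree K (E \<inter> K \<times> K))"


section \<open>OR-scheduling\<close>

text \<open>A schedule \<open>S\<close> is given by the start times; since jobs are not preempted, job \<open>j\<close>
  occupies the machine from \<open>S j\<close> to \<open>S j + p j\<close>. Idle time is allowed.\<close>

definition feasible ::
  "'a set \<Rightarrow> ('a \<times> 'a) set \<Rightarrow> ('a \<Rightarrow> real) \<Rightarrow> ('a \<Rightarrow> real) \<Rightarrow> bool" where
  "feasible V E p S \<longleftrightarrow>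
     (\<forall>j\<in>V. 0 \<le> S j) \<and>
     (\<forall>i\<in>V. \<forall>j\<in>V. i \<noteq> j \<longrightarrow> S i + p i \<le> S j \<or> S j + p j \<le> S i) \<and>
     (\<forall>j\<in>V. (\<exists>i. (i, j) \<in> E) \<longrightarrow> (\<exists>i. (i, j) \<in> E \<and> S i + p i \<le> S j))"

definition objective ::
  "'a set \<Rightarrow> ('a \<Rightarrow> real) \<Rightarrow> ('a \<Rightarrow> real) \<Rightarrow> ('a \<Rightarrow> real) \<Rightarrow> real" where
  "objective V p w S = (\<Sum>j\<in>V. w j * (S j + p j))"

definition optimum ::
  "'a set \<Rightarrow> ('a \<times> 'a) set \<Rightarrow> ('a \<Rightarrow> real) \<Rightarrow> ('a \<Rightarrow> real) \<Rightarrow> real" where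
  "optimum V E p w = Inf {objective V p w S |S. feasible V E p S}"


section \<open>Model of computation\<close>

text \<open>
  Structured programs for a random access machine with the logarithmic cost criterion,
  which is polynomially equivalent to Turing machines. The memory consists of arrays of
  natural numbers of unbounded length; a program refers to finitely many of them by name,
  and index 0 of an array can serve as a scalar variable. Every evaluation of a
  subexpression is charged with the bit length of its value, so that addresses, operands
  and results (in particular of multiplications) are all paid for by their length.
\<close>

type_synonym memory = "string \<Rightarrow> nat \<Rightarrow> nat"

definition bits :: "nat \<Rightarrow> nat" where
  "bits x = Suc (floorlog 2 x)"

datatype aexp =
    Num nat
  | Cell string aexp
  | Add aexp aexp
  | Sub aexp aexp
  | Mult aexp aexp

fun aval :: "aexp \<Rightarrow> memory \<Rightarrow> nat" where
  "aval (Num k) s = k"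
| "aval (Cell x a) s = s x (aval a s)"
| "aval (Add a b) s = aval a s + aval b s"
| "aval (Sub a b) s = aval a s - aval b s"
| "aval (Mult a b) s = aval a s * aval b s"

fun acost :: "aexp \<Rightarrow> memory \<Rightarrow> nat" where
  "acost (Num k) s = bits k"
| "acost (Cell x a) s = acost a s + bits (s x (aval a s))"
| "acost (Add a b) s = acost a s + acost b s + bits (aval a s + aval b s)"
| "acost (Sub a b) s = acost a s + acost b s + bits (aval a s - aval b s)"
| "acost (Mult a b) s = acost a s + acost b s + bits (aval a s * aval b s)"

text \<open>\<open>Assign x a b\<close> stores the value of \<open>b\<close> in array \<open>x\<close> at the index given by \<open>a\<close>.
  Tests succeed on nonzero values.\<close>

datatype com =
    Skip
  | Assign string aexp aexp
  | Seq com com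
  | If aexp com com
  | While aexp com

text \<open>\<open>exec c s t s'\<close>: started in memory \<open>s\<close>, program \<open>c\<close> halts after time \<open>t\<close> with
  memory \<open>s'\<close>.\<close>

inductive exec :: "com \<Rightarrow> memory \<Rightarrow> nat \<Rightarrow> memory \<Rightarrow> bool" where
  Skip: "exec Skip s 1 s"
| Assign: "exec (Assign x a b) s (1 + acost a s + acost b s) (s(x := (s x)(aval a s := aval b s)))"
| Seq: "exec c1 s t1 s1 \<Longrightarrow> exec c2 s1 t2 s2 \<Longrightarrow> exec (Seq c1 c2) s (t1 + t2) s2"
| IfTrue: "aval b s \<noteq> 0 \<Longrightarrow> exec c1 s t s' \<Longrightarrow> exec (If b c1 c2) s (acost b s + t) s'"
| IfFalse: "aval b s = 0 \<Longrightarrow> exec c2 s t s' \<Longrightarrow> exec (If b c1 c2) s (acost b s + t) s'"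
| WhileFalse: "aval b s = 0 \<Longrightarrow> exec (While b c) s (acost b s) s"
| WhileTrue: "aval b s \<noteq> 0 \<Longrightarrow> exec c s t1 s1 \<Longrightarrow> exec (While b c) s1 t2 s2 \<Longrightarrow>
    exec (While b c) s (acost b s + t1 + t2) s2"

inductive_cases exec_SkipE: "exec Skip s t s'"
inductive_cases exec_AssignE: "exec (Assign x a b) s t s'"
inductive_cases exec_SeqE: "exec (Seq c1 c2) s t s'"
inductive_cases exec_IfE: "exec (If b c1 c2) s t s'"
inductive_cases exec_WhileE: "exec (While b c) s t s'"

lemma exec_deterministic:
  "exec c s t s' \<Longrightarrow> exec c s u s'' \<Longrightarrow> t = u \<and> s' = s''"
proof (induction arbitrary: u s'' rule: exec.induct)
  case (Skip s)
  from Skip show ?case by (rule exec_SkipE) simp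
next
  case (Assign x a b s)
  from Assign show ?case by (rule exec_AssignE) simp
next
  case (Seq c1 s t1 s1 c2 t2 s2)
  from Seq.prems obtain u1 r1 u2
    where r: "exec c1 s u1 r1" "exec c2 r1 u2 s''" "u = u1 + u2"
    by (rule exec_SeqE)
  from Seq.IH(1)[OF r(1)] have 1: "u1 = t1" "r1 = s1" by simp_all
  from Seq.IH(2)[OF r(2)[unfolded 1]] show ?case by (simp add: r(3) 1)
next
  case (IfTrue b s c1 t s' c2)
  from IfTrue.prems obtain u' where r: "exec c1 s u' s''" "u = acost b s + u'"
    by (rule exec_IfE) (use IfTrue.hyps(1) in auto)
  from IfTrue.IH[OF r(1)] show ?case by (simp add: r(2))
next
  case (IfFalse b s c2 t s' c1)
  from IfFalse.prems obtain u' where r: "exec c2 s u' s''" "u = acost b s + u'"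
    by (rule exec_IfE) (use IfFalse.hyps(1) in auto)
  from IfFalse.IH[OF r(1)] show ?case by (simp add: r(2))
next
  case (WhileFalse b s c)
  from WhileFalse.prems show ?case by (rule exec_WhileE) (use WhileFalse.hyps in auto)
next
  case (WhileTrue b s c t1 s1 t2 s2)
  from WhileTrue.prems obtain u1 r1 u2
    where r: "exec c s u1 r1" "exec (While b c) r1 u2 s''" "u = acost b s + u1 + u2"
    by (rule exec_WhileE) (use WhileTrue.hyps(1) in auto)
  from WhileTrue.IH(1)[OF r(1)] have 1: "u1 = t1" "r1 = s1" by simp_all
  from WhileTrue.IH(2)[OF r(2)[unfolded 1]] show ?case by (simp add: r(3) 1)
qed


section \<open>Instances as inputs of programs\<close>

text \<open>For the purpose of encoding, the jobs are numbered \<open>0, \<dots>, njobs - 1\<close> and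
  processing times and weights are rational.\<close>

record or_instance =
  njobs :: nat
  prec :: "(nat \<times> nat) set"
  ptime :: "nat \<Rightarrow> rat"
  weight :: "nat \<Rightarrow> rat"

definition jobs :: "or_instance \<Rightarrow> nat set" where
  "jobs I = {..<njobs I}"

definition valid_instance :: "or_instance \<Rightarrow> bool" where
  "valid_instance I \<longleftrightarrow> dag (jobs I) (prec I) \<and> (\<forall>j\<in>jobs I. 0 \<le> ptime I j \<and> 0 \<le> weight I j)"

abbreviation rptime :: "or_instance \<Rightarrow> nat \<Rightarrow> real" where
  "rptime I j \<equiv> of_rat (ptime I j)"

abbreviation rweight :: "or_instance \<Rightarrow> nat \<Rightarrow> real" where
  "rweight I j \<equiv> of_rat (weight I j)"

text \<open>Numerators and denominators (in lowest terms) are stored separately, and the graph is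
  given by its adjacency matrix in row-major order.\<close>

definition numerator :: "rat \<Rightarrow> nat" where
  "numerator r = nat (fst (quotient_of r))"

definition denominator :: "rat \<Rightarrow> nat" where
  "denominator r = nat (snd (quotient_of r))"

definition adjacency :: "or_instance \<Rightarrow> nat \<Rightarrow> nat" where
  "adjacency I k = (if (k div njobs I, k mod njobs I) \<in> prec I then 1 else 0)"

definition encode :: "or_instance \<Rightarrow> memory" where
  "encode I = (\<lambda>x i. 0)(
     ''n'' := (\<lambda>i. if i = 0 then njobs I else 0),
     ''p_num'' := (\<lambda>j. if j < njobs I then numerator (ptime I j) else 0),
     ''p_den'' := (\<lambda>j. if j < njobs I then denominator (ptime I j) else 0),
     ''w_num'' := (\<lambda>j. if j < njobs I then numerator (weight I j) else 0),
     ''w_den'' := (\<lambda>j. if j < njobs I then denominator (weight I j) else 0),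
     ''adj'' := (\<lambda>k. if k < njobs I * njobs I then adjacency I k else 0))"

definition input_size :: "or_instance \<Rightarrow> nat" where
  "input_size I =
     bits (njobs I) +
     (\<Sum>j<njobs I. bits (numerator (ptime I j)) + bits (denominator (ptime I j)) +
                  bits (numerator (weight I j)) + bits (denominator (weight I j))) +
     (\<Sum>k<njobs I * njobs I. bits (adjacency I k))"

text \<open>A program outputs the start time of each job as a fraction.\<close>

definition wf_output :: "or_instance \<Rightarrow> memory \<Rightarrow> bool" where
  "wf_output I s \<longleftrightarrow> (\<forall>j\<in>jobs I. s ''S_den'' j > 0)"

definition decode :: "memory \<Rightarrow> nat \<Rightarrow> real" where
  "decode s j = of_nat (s ''S_num'' j) / of_nat (s ''S_den'' j)"


section \<open>Approximation algorithms\<close>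

definition poly_time_approx_algorithm :: "real \<Rightarrow> or_instance set \<Rightarrow> com \<Rightarrow> bool" where
  "poly_time_approx_algorithm \<alpha> \<I> c \<longleftrightarrow>
     (\<exists>q :: nat poly. \<forall>I\<in>\<I>. \<exists>t s.
        exec c (encode I) t s \<and>
        t \<le> poly q (input_size I) \<and>
        wf_output I s \<and>
        feasible (jobs I) (prec I) (rptime I) (decode s) \<and>
        objective (jobs I) (rptime I) (rweight I) (decode s)
          \<le> \<alpha> * optimum (jobs I) (prec I) (rptime I) (rweight I))"

end

theory Submission
  imports Defs
begin

text \<open>
  The algorithm is greedy: among all paths of unscheduled jobs that start at an available job it
  schedules one of maximal density, that is, of maximal ratio of weight to processing time. As
  every job has at most one successor, any set of jobs that can be completed next is a disjoint
  union of such paths, so it is no denser than the chosen path. If the remaining weight is \<open>R\<close>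
  and the chosen path has processing time \<open>a\<close> and weight \<open>b\<close>, then at time \<open>R a / (2 b)\<close>
  every schedule still has unfinished weight at least \<open>R / 2\<close>. Comparing histograms, the cost
  \<open>\<Sum> R a\<close> of the greedy schedule is at most 4 times the optimum. There are only quadratically
  many paths.

  A loop whose number of iterations is the number of jobs lengthens the numbers in memory only
  polynomially if products are formed with input numbers only. Hence a program built from such
  loops terminates in polynomial time, and its effect can be described by a function.
\<close>


section \<open>Loop programs\<close>

text \<open>In the histogram of a schedule each job is a column whose width is its weight and whose
  height is its completion time. The area is the cost, and the width at height t is the weight
  unfinished at time t. The greedy schedule is drawn differently: a path of time a and weight b,
  chosen while weight R remains, becomes a column of width b and height R a / b, with total area
  \<Sum> R a. Halved in width and height and aligned with the late jobs, these columns fit below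
  every feasible histogram, because nothing that can be done next is denser than b / a. The two
  halvings are the factor 4.

  Zero times and zero weights are allowed, so a density may be 0 / 0 or infinite; all densities are
  therefore compared by cross multiplication. The machine has no division either, and long numbers
  cost time. Hence times and weights are first scaled to integers, with input denominators as the
  only multipliers of stored numbers.\<close>

datatype loop_prog =
    Put string aexp aexp
  | Then loop_prog loop_prog (infixr ";;" 60)
  | When aexp loop_prog
  | For string loop_prog

abbreviation var :: "string \<Rightarrow> aexp" where
  "var x \<equiv> Cell x (Num 0)"

text \<open>All loops have the number of jobs, stored in \<open>n\<close>, as their number of iterations.\<close>

primrec compile :: "loop_prog \<Rightarrow> com" where
  "compile (Put x a b) = Assign x a b"
| "compile (c ;; d) = Seq (compile c) (compile d)"
| "compile (When b c) = If b (compile c) Skip"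
| "compile (For i c) = Seq (Assign i (Num 0) (Num 0))
     (While (Sub (var ''n'') (var i)) (Seq (compile c) (Assign i (Num 0) (Add (var i) (Num 1)))))"

definition store :: "string \<Rightarrow> nat \<Rightarrow> nat \<Rightarrow> memory \<Rightarrow> memory" where
  "store x i v s = s(x := (s x)(i := v))"

text \<open>\<open>For\<close> iterates exactly \<open>n\<close> times, whatever the body does to
  the counter. This agrees with the compiled \<open>While\<close> if the body preserves
  \<open>n\<close> and the counter, which \<open>well_formed\<close> demands.\<close>

primrec run :: "nat \<Rightarrow> loop_prog \<Rightarrow> memory \<Rightarrow> memory" where
  "run n (Put x a b) s = store x (aval a s) (aval b s) s"
| "run n (c ;; d) s = run n d (run n c s)"
| "run n (When b c) s = (if aval b s \<noteq> 0 then run n c s else s)"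
| "run n (For i c) s = ((\<lambda>s. store i 0 (Suc (run n c s i 0)) (run n c s)) ^^ n) (store i 0 0 s)"

primrec assigned :: "loop_prog \<Rightarrow> string set" where
  "assigned (Put x a b) = {x}"
| "assigned (c ;; d) = assigned c \<union> assigned d"
| "assigned (When b c) = assigned c"
| "assigned (For i c) = insert i (assigned c)"

lemma store_same [simp]: "store x i v s x = (s x)(i := v)"
  and store_other: "x \<noteq> y \<Longrightarrow> store x i v s y = s y"
  by (simp_all add: store_def)

lemma run_frame: "x \<notin> assigned c \<Longrightarrow> run n c s x = s x"
proof (induction c arbitrary: s)
  case (For i c)
  have "((\<lambda>s. store i 0 (Suc (run n c s i 0)) (run n c s)) ^^ m) s x = s x" for m s
    using For by (induction m arbitrary: s) (auto simp: store_other)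
  then show ?case using For by (auto simp: store_other)
qed (auto simp: store_other)

text \<open>The body leaves \<open>i\<close> alone, so the counter is known to be \<open>k\<close>
  at the start of iteration \<open>k\<close> and need not be carried in the invariant.\<close>

lemma run_For_invariant:
  assumes "i \<notin> assigned c" "I 0 (store i 0 0 s)"
    and "\<And>k s. k < n \<Longrightarrow> s i 0 = k \<Longrightarrow> I k s \<Longrightarrow> I (Suc k) (store i 0 (Suc k) (run n c s))"
  shows "I n (run n (For i c) s)"
proof -
  let ?f = "\<lambda>s. store i 0 (Suc (run n c s i 0)) (run n c s)"
  have "m \<le> n \<Longrightarrow> I m ((?f ^^ m) (store i 0 0 s)) \<and> (?f ^^ m) (store i 0 0 s) i 0 = m" for m
  proof (induction m)
    case (Suc m)
    then have IH: "I m ((?f ^^ m) (store i 0 0 s))" "(?f ^^ m) (store i 0 0 s) i 0 = m" by auto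
    then show ?case
      using assms(3)[OF _ IH(2) IH(1)] Suc.prems by (simp add: run_frame[OF assms(1)])
  qed (simp add: assms(2))
  then show ?thesis by simp
qed

section \<open>Lengths of numbers and costs of expressions\<close>

definition cells_below :: "nat \<Rightarrow> memory \<Rightarrow> bool" where
  "cells_below L s \<longleftrightarrow> (\<forall>x i. s x i < 2 ^ L)"

text \<open>The constants 0 and 1 fit below \<open>2 ^ L\<close> for every positive
  \<open>L\<close>, so constants ask nothing more of \<open>L\<close>.\<close>

primrec small_consts :: "aexp \<Rightarrow> bool" where
  "small_consts (Num k) = (k \<le> 1)"
| "small_consts (Cell x a) = small_consts a"
| "small_consts (Add a b) = (small_consts a \<and> small_consts b)"
| "small_consts (Sub a b) = (small_consts a \<and> small_consts b)"
| "small_consts (Mult a b) = (small_consts a \<and> small_consts b)"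

primrec nodes :: "aexp \<Rightarrow> nat" where
  "nodes (Num k) = 1"
| "nodes (Cell x a) = Suc (nodes a)"
| "nodes (Add a b) = Suc (nodes a + nodes b)"
| "nodes (Sub a b) = Suc (nodes a + nodes b)"
| "nodes (Mult a b) = Suc (nodes a + nodes b)"

lemma bits_le: "x < 2 ^ k \<Longrightarrow> bits x \<le> Suc k"
  by (simp add: bits_def floorlog_leI)

lemma add_less_power:
  assumes "(x::nat) < 2 ^ a" "y < 2 ^ b" "0 < a" "0 < b"
  shows "x + y < 2 ^ (a + b)"
proof -
  obtain a' b' where ab: "a = Suc a'" "b = Suc b'" using assms by (auto simp: gr0_conv_Suc)
  have "2 ^ a \<le> (2 ^ (a + b') :: nat)" "2 ^ b \<le> (2 ^ (a' + b) :: nat)"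
    by (intro power_increasing; simp add: ab)+
  moreover have "(2::nat) ^ (a + b) = 2 ^ (a + b') + 2 ^ (a' + b)" using ab by simp
  ultimately show ?thesis using assms by linarith
qed

lemma mult_less_power: "(x::nat) < 2 ^ a \<Longrightarrow> y < 2 ^ b \<Longrightarrow> x * y < 2 ^ (a + b)"
  by (simp add: power_add mult_strict_mono')

lemma nodes_pos: "0 < nodes a"
  by (cases a) auto

text \<open>The exponents of the operands add up: in a product by the law of powers, in a sum
  because both exponents are positive.\<close>

lemma aval_less:
  assumes "cells_below L s" "0 < L"
  shows "small_consts a \<Longrightarrow> aval a s < 2 ^ (L * nodes a)"
proof (induction a)
  case (Num k)
  have "(2::nat) ^ 1 \<le> 2 ^ L" using assms by (intro power_increasing) auto
  then show ?case using Num by simp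
next
  case (Cell x a)
  have "s x (aval a s) < 2 ^ L" using assms by (simp add: cells_below_def)
  also have "\<dots> \<le> 2 ^ (L * nodes (Cell x a))" using assms by (intro power_increasing) auto
  finally show ?case by simp
next
  case (Add a b)
  have "aval a s + aval b s < 2 ^ (L * nodes a + L * nodes b)"
    using Add assms nodes_pos by (intro add_less_power) auto
  also have "\<dots> \<le> 2 ^ (L * nodes (Add a b))" by (intro power_increasing) (auto simp: algebra_simps)
  finally show ?case by simp
next
  case (Sub a b)
  have "aval a s - aval b s < 2 ^ (L * nodes a)" using Sub by (simp add: less_imp_diff_less)
  also have "\<dots> \<le> 2 ^ (L * nodes (Sub a b))" by (intro power_increasing) (auto simp: algebra_simps)
  finally show ?case by simp
next
  case (Mult a b)
  have "aval a s * aval b s < 2 ^ (L * nodes a + L * nodes b)"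
    using Mult by (intro mult_less_power) auto
  also have "\<dots> \<le> 2 ^ (L * nodes (Mult a b))" by (intro power_increasing) (auto simp: algebra_simps)
  finally show ?case by simp
qed

text \<open>At most \<open>nodes a\<close> subexpressions are charged, each for a value of binary
  length at most \<open>L * nodes a\<close>; hence the square.\<close>

lemma acost_le:
  assumes "cells_below L s" "0 < L"
  shows "small_consts a \<Longrightarrow> acost a s \<le> (nodes a)\<^sup>2 * Suc L"
proof (induction a)
  case (Num k)
  then show ?case using bits_le[OF aval_less[OF assms, of "Num k"]] by simp
next
  case (Cell x a)
  have "bits (s x (aval a s)) \<le> Suc L" using assms by (intro bits_le) (simp add: cells_below_def)
  then have "acost (Cell x a) s \<le> ((nodes a)\<^sup>2 + 1) * Suc L" using Cell by simp
  also have "\<dots> \<le> (nodes (Cell x a))\<^sup>2 * Suc L"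
    by (intro mult_right_mono) (auto simp: power2_eq_square)
  finally show ?case .
next
  case (Add a b)
  have "bits (aval (Add a b) s) \<le> Suc (L * nodes (Add a b))" using Add by (intro bits_le aval_less[OF assms]) auto
  also have "\<dots> \<le> nodes (Add a b) * Suc L" by simp
  finally have "acost (Add a b) s \<le> ((nodes a)\<^sup>2 + (nodes b)\<^sup>2 + nodes (Add a b)) * Suc L"
    using Add by (simp add: algebra_simps)
  also have "\<dots> \<le> (nodes (Add a b))\<^sup>2 * Suc L"
    by (intro mult_right_mono) (auto simp: power2_eq_square algebra_simps)
  finally show ?case .
next
  case (Sub a b)
  have "bits (aval (Sub a b) s) \<le> Suc (L * nodes (Sub a b))" using Sub by (intro bits_le aval_less[OF assms]) auto
  also have "\<dots> \<le> nodes (Sub a b) * Suc L" by simp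
  finally have "acost (Sub a b) s \<le> ((nodes a)\<^sup>2 + (nodes b)\<^sup>2 + nodes (Sub a b)) * Suc L"
    using Sub by (simp add: algebra_simps)
  also have "\<dots> \<le> (nodes (Sub a b))\<^sup>2 * Suc L"
    by (intro mult_right_mono) (auto simp: power2_eq_square algebra_simps)
  finally show ?case .
next
  case (Mult a b)
  have "bits (aval (Mult a b) s) \<le> Suc (L * nodes (Mult a b))" using Mult by (intro bits_le aval_less[OF assms]) auto
  also have "\<dots> \<le> nodes (Mult a b) * Suc L" by simp
  finally have "acost (Mult a b) s \<le> ((nodes a)\<^sup>2 + (nodes b)\<^sup>2 + nodes (Mult a b)) * Suc L"
    using Mult by (simp add: algebra_simps)
  also have "\<dots> \<le> (nodes (Mult a b))\<^sup>2 * Suc L"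
    by (intro mult_right_mono) (auto simp: power2_eq_square algebra_simps)
  finally show ?case .
qed

text \<open>Assigned values may contain a product only if one factor is an entry of an input array, so
  that an assignment lengthens the largest number in memory by at most the input length.\<close>

fun slow :: "string set \<Rightarrow> aexp \<Rightarrow> bool" where
  "slow X (Num k) = (k \<le> 1)"
| "slow X (Cell x a) = True"
| "slow X (Add (Cell x a) (Cell y b)) = True"
| "slow X (Add (Cell x a) (Num k)) = (k \<le> 1)"
| "slow X (Mult (Cell x a) (Cell y b)) = (y \<in> X)"
| "slow X _ = False"

lemma aval_slow:
  assumes "slow X a" "cells_below L s" "\<forall>x\<in>X. \<forall>i. s x i < 2 ^ B" "0 < L" "0 < B"
  shows "aval a s < 2 ^ (L + B)"
proof -
  have c: "s x i < 2 ^ L" for x i using assms(2) by (simp add: cells_below_def)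
  have B: "2 \<le> (2::nat) ^ B" and L: "2 \<le> (2::nat) ^ L"
    using assms(4,5) power_increasing[of 1 B "2::nat"] power_increasing[of 1 L "2::nat"] by auto
  have le: "(2::nat) * 2 ^ L \<le> 2 ^ (L + B)" "(2::nat) ^ L \<le> 2 ^ (L + B)"
    using B by (auto simp: power_add)
  from assms(1) show ?thesis
  proof (cases "(X, a)" rule: slow.cases)
    case (1 X k) then show ?thesis using assms(1) L le by simp
  next
    case (2 X x a) then show ?thesis using c[of x "aval a s"] le by simp
  next
    case (3 X x a y b) then show ?thesis using c[of x "aval a s"] c[of y "aval b s"] le by simp
  next
    case (4 X x a k) then show ?thesis using c[of x "aval a s"] assms(1) L le by simp
  next
    case (5 X x a y b) then show ?thesis using c assms(1,3) by (auto intro!: mult_less_power)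
  qed auto
qed

text \<open>Only the stored value must be \<open>slow\<close>. Indices and conditions may contain
  any products, since their values never enter memory and are paid for by
  \<open>acost_le\<close>.\<close>

primrec well_formed :: "string set \<Rightarrow> loop_prog \<Rightarrow> bool" where
  "well_formed X (Put x a b) = (x \<notin> insert ''n'' X \<and> small_consts a \<and> small_consts b \<and> slow X b)"
| "well_formed X (c ;; d) = (well_formed X c \<and> well_formed X d)"
| "well_formed X (When b c) = (small_consts b \<and> well_formed X c)"
| "well_formed X (For i c) = (i \<notin> insert ''n'' X \<and> i \<notin> assigned c \<and> well_formed X c)"

text \<open>This polynomial in the number of jobs serves twice: as a factor of the running time and,
  times the input length, as a bound on the growth of numbers. In a loop, two steps per iteration
  stand for test and increment, and two more for initialization and the final test.\<close>

primrec steps :: "loop_prog \<Rightarrow> nat poly" where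
  "steps (Put x a b) = 1"
| "steps (c ;; d) = steps c + steps d"
| "steps (When b c) = 1 + steps c"
| "steps (For i c) = 2 + [:0, 1:] * (steps c + 2)"

text \<open>The cost of a step in units of \<open>Suc M\<close>. A loop test has 5 nodes and costs
  at most 25 units, the increment 18; together they are covered by two steps of 30 units.\<close>

primrec step_cost :: "loop_prog \<Rightarrow> nat" where
  "step_cost (Put x a b) = 1 + (nodes a)\<^sup>2 + (nodes b)\<^sup>2"
| "step_cost (c ;; d) = step_cost c + step_cost d"
| "step_cost (When b c) = 1 + (nodes b)\<^sup>2 + step_cost c"
| "step_cost (For i c) = 30 + step_cost c"

lemma well_formed_assigned: "well_formed X c \<Longrightarrow> assigned c \<inter> insert ''n'' X = {}"
  by (induction c) auto

section \<open>Running time of compiled loop programs\<close>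

definition exec_le :: "com \<Rightarrow> memory \<Rightarrow> nat \<Rightarrow> memory \<Rightarrow> bool" where
  "exec_le c s T s' \<longleftrightarrow> (\<exists>t\<le>T. exec c s t s')"

lemma exec_le_mono: "exec_le c s T s' \<Longrightarrow> T \<le> T' \<Longrightarrow> exec_le c s T' s'"
  unfolding exec_le_def using order.trans by blast

lemma exec_le_Seq: "exec_le c s T s1 \<Longrightarrow> exec_le d s1 T' s2 \<Longrightarrow> exec_le (Seq c d) s (T + T') s2"
  unfolding exec_le_def by (meson add_mono exec.Seq)

lemma exec_le_WhileFalse: "aval b s = 0 \<Longrightarrow> acost b s \<le> T \<Longrightarrow> exec_le (While b c) s T s"
  unfolding exec_le_def by (meson exec.WhileFalse)

lemma exec_le_WhileTrue:
  assumes "aval b s \<noteq> 0" "acost b s \<le> T0" "exec_le c s T s1" "exec_le (While b c) s1 T' s2"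
  shows "exec_le (While b c) s (T0 + T + T') s2"
  using assms unfolding exec_le_def by (meson add_mono exec.WhileTrue)

lemma exec_le_Assign:
  assumes "cells_below L s" "0 < L" "small_consts a" "small_consts b" "L \<le> M"
  shows "exec_le (Assign x a b) s ((1 + (nodes a)\<^sup>2 + (nodes b)\<^sup>2) * Suc M) (store x (aval a s) (aval b s) s)"
proof -
  have "acost a s \<le> (nodes a)\<^sup>2 * Suc M" "acost b s \<le> (nodes b)\<^sup>2 * Suc M"
    using acost_le[OF assms(1,2)] assms(3-5) by (meson Suc_le_mono mult_le_mono2 order.trans)+
  then have "1 + acost a s + acost b s \<le> (1 + (nodes a)\<^sup>2 + (nodes b)\<^sup>2) * Suc M"
    by (simp add: algebra_simps)
  moreover have "exec (Assign x a b) s (1 + acost a s + acost b s) (store x (aval a s) (aval b s) s)"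
    unfolding store_def by (rule exec.Assign)
  ultimately show ?thesis unfolding exec_le_def by blast
qed

lemma cells_below_store:
  assumes "cells_below L s" "v < 2 ^ (L + B)"
  shows "cells_below (L + B) (store x i v s)"
proof -
  have "s y k < 2 ^ (L + B)" for y k
    using assms(1) unfolding cells_below_def by (meson le_add1 less_le_trans one_le_numeral power_increasing)
  then show ?thesis using assms(2) by (auto simp: cells_below_def store_def)
qed

lemma cells_below_mono: "cells_below L s \<Longrightarrow> L \<le> L' \<Longrightarrow> cells_below L' s"
  unfolding cells_below_def by (meson less_le_trans one_le_numeral power_increasing)

text \<open>Each step lengthens the numbers in memory by at most \<open>B\<close> bits. The
  induction lets the current length \<open>L\<close> grow but keeps \<open>M\<close>, a bound on the
  final length, fixed, so that every step is charged at the same rate and costs simply add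
  up.\<close>

lemma compile_time:
  assumes "well_formed X c" "s ''n'' 0 = n" "\<forall>x\<in>X. \<forall>i. s x i < 2 ^ B" "0 < B"
    "cells_below L s" "0 < L" "L + B * poly (steps c) n \<le> M"
  shows "exec_le (compile c) s (poly (steps c) n * step_cost c * Suc M) (run n c s) \<and>
    cells_below (L + B * poly (steps c) n) (run n c s)"
  using assms
proof (induction c arbitrary: s L)
  case (Put x a b)
  then show ?case
    using exec_le_Assign[of L s a b M x] aval_slow[of X b L s B] by (auto intro!: cells_below_store)
next
  case (Then c d)
  let ?s = "run n c s" and ?L = "L + B * poly (steps c) n"
  have c: "exec_le (compile c) s (poly (steps c) n * step_cost c * Suc M) ?s" "cells_below ?L ?s"
    using Then.IH(1)[of s L] Then.prems by (auto simp: algebra_simps)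
  have fr: "?s x = s x" if "x \<in> insert ''n'' X" for x
    using that well_formed_assigned[of X c] Then.prems(1) by (intro run_frame) auto
  have d: "exec_le (compile d) ?s (poly (steps d) n * step_cost d * Suc M) (run n d ?s)"
    "cells_below (?L + B * poly (steps d) n) (run n d ?s)"
    using Then.IH(2)[of ?s ?L] Then.prems c fr by (auto simp: algebra_simps)
  have "exec_le (compile (c ;; d)) s (poly (steps c) n * step_cost c * Suc M +
      poly (steps d) n * step_cost d * Suc M) (run n d ?s)"
    using exec_le_Seq[OF c(1) d(1)] by simp
  then have "exec_le (compile (c ;; d)) s (poly (steps (c ;; d)) n * step_cost (c ;; d) * Suc M) (run n d ?s)"
    by (rule exec_le_mono) (simp add: algebra_simps)
  then show ?case using d(2) by (simp add: algebra_simps)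
next
  case (When b c)
  have ab: "acost b s \<le> (nodes b)\<^sup>2 * Suc M"
    using acost_le[of L s b] When.prems by (meson Suc_le_mono add_leD1 mult_le_mono2 order.trans well_formed.simps(3))
  show ?case
  proof (cases "aval b s = 0")
    case True
    have "exec (compile (When b c)) s (acost b s + 1) s"
      using exec.IfFalse[OF True exec.Skip] by simp
    moreover have "acost b s + 1 \<le> poly (steps (When b c)) n * step_cost (When b c) * Suc M"
      using ab by (simp add: algebra_simps)
    ultimately show ?thesis using True When.prems by (auto simp: exec_le_def intro: cells_below_mono)
  next
    case False
    have c: "exec_le (compile c) s (poly (steps c) n * step_cost c * Suc M) (run n c s)"
      "cells_below (L + B * poly (steps c) n) (run n c s)"
      using When.IH[of s L] When.prems by (auto simp: algebra_simps)
    then obtain t where t: "exec (compile c) s t (run n c s)" "t \<le> poly (steps c) n * step_cost c * Suc M"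
      by (auto simp: exec_le_def)
    have "exec (compile (When b c)) s (acost b s + t) (run n c s)"
      using False t(1) by (auto intro: exec.intros)
    moreover have "acost b s + t \<le> poly (steps (When b c)) n * step_cost (When b c) * Suc M"
      using ab t(2) by (simp add: algebra_simps)
    ultimately show ?thesis using False c(2)
      by (auto simp: exec_le_def algebra_simps intro: cells_below_mono)
  qed
next
  case (For i c)
  let ?f = "\<lambda>s. store i 0 (Suc (run n c s i 0)) (run n c s)"
  let ?b = "Sub (var ''n'') (var i)"
  let ?body = "Seq (compile c) (Assign i (Num 0) (Add (var i) (Num 1)))"
  let ?q = "poly (steps c) n"
  let ?r = "?q + 2"
  let ?k = "step_cost c + 30"
  note prems = For.prems
  have test: "acost ?b s \<le> 25 * Suc L" if "cells_below L s" "0 < L" for s L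
  proof -
    have "(nodes ?b)\<^sup>2 = 25" by (simp add: power2_eq_square)
    then show ?thesis using acost_le[OF that, of ?b] by (simp only: small_consts.simps le0)
  qed
  \<comment> \<open>Generalized to a loop with \<open>m\<close> iterations still to come, since
    \<open>While\<close> unfolds from the front.\<close>
  have loop: "exec_le (While ?b ?body) s ((m * ?r + 1) * ?k * Suc M) ((?f ^^ m) s) \<and>
      cells_below (L + B * (m * ?r)) ((?f ^^ m) s)"
    if "s ''n'' 0 = n" "\<forall>x\<in>X. \<forall>i. s x i < 2 ^ B" "cells_below L s" "0 < L"
      "s i 0 + m = n" "L + B * (m * ?r) \<le> M" for s L m
    using that
  proof (induction m arbitrary: s L)
    case 0
    have "acost ?b s \<le> 25 * Suc L" using 0 by (intro test)
    also have "\<dots> \<le> ?k * Suc M" using 0 by (intro mult_mono) auto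
    finally show ?case using 0 by (auto intro!: exec_le_WhileFalse)
  next
    case (Suc m)
    let ?s = "run n c s"
    have *: "L + B * ?q \<le> M" "(L + B * ?q) + B \<le> M" "(L + B * ?r) + B * (m * ?r) \<le> M"
      using Suc.prems(6) by (auto simp: algebra_simps)
    have c: "exec_le (compile c) s (?q * step_cost c * Suc M) ?s" "cells_below (L + B * ?q) ?s"
      using For.IH[of s L] Suc.prems prems * by auto
    have fr: "?s x = s x" if "x \<in> insert i (insert ''n'' X)" for x
      using that well_formed_assigned[of X c] prems(1) by (intro run_frame) auto
    have fr2: "?f s x = s x" if "x \<in> insert ''n'' X" for x
      using that fr[of x] prems(1) by (subst store_other) auto
    have "exec_le (Assign i (Num 0) (Add (var i) (Num 1))) ?s (18 * Suc M) (?f s)"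
      using exec_le_Assign[OF c(2), of "Num 0" "Add (var i) (Num 1)" M i] Suc.prems * by (auto elim!: exec_le_mono simp: power2_eq_square)
    from exec_le_Seq[OF c(1) this]
    have body: "exec_le ?body s (?q * step_cost c * Suc M + 18 * Suc M) (?f s)" .
    have "aval (Add (var i) (Num 1)) ?s < 2 ^ ((L + B * ?q) + B)"
      by (rule aval_slow[of X]) (use c Suc.prems prems fr in auto)
    then have cb: "cells_below ((L + B * ?q) + B) (?f s)"
      using cells_below_store[OF c(2)] by simp
    then have cb: "cells_below (L + B * ?r) (?f s)"
      by (rule cells_below_mono) (simp add: algebra_simps)
    have IH: "exec_le (While ?b ?body) (?f s) ((m * ?r + 1) * ?k * Suc M) ((?f ^^ m) (?f s))"
       "cells_below (L + B * ?r + B * (m * ?r)) ((?f ^^ m) (?f s))"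
      using Suc.IH[of "?f s" "L + B * ?r"] Suc.prems cb fr fr2 * by auto
    have "acost ?b s \<le> 25 * Suc L" using Suc.prems by (intro test)
    also have "\<dots> \<le> 25 * Suc M" using * by (intro mult_mono) auto
    finally have "exec_le (While ?b ?body) s (25 * Suc M + (?q * step_cost c * Suc M + 18 * Suc M)
        + (m * ?r + 1) * ?k * Suc M) ((?f ^^ m) (?f s))"
      using Suc.prems IH(1) body by (intro exec_le_WhileTrue) auto
    moreover have "25 * Suc M + (?q * step_cost c * Suc M + 18 * Suc M) + (m * ?r + 1) * ?k * Suc M
       \<le> (Suc m * ?r + 1) * ?k * Suc M"
    proof -
      have "25 + (?q * step_cost c + 18) + (m * ?r + 1) * ?k \<le> (Suc m * ?r + 1) * ?k"
        by (simp add: algebra_simps)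
      from mult_le_mono1[OF this, of "Suc M"] show ?thesis by (simp only: distrib_right)
    qed
    ultimately have "exec_le (While ?b ?body) s ((Suc m * ?r + 1) * ?k * Suc M) ((?f ^^ m) (?f s))"
      by (rule exec_le_mono)
    moreover have "(?f ^^ Suc m) s = (?f ^^ m) (?f s)" by (simp only: funpow_Suc_right o_apply)
    moreover have "L + B * ?r + B * (m * ?r) = L + B * (Suc m * ?r)" by (simp add: algebra_simps)
    ultimately show ?case using IH(2) by presburger
  qed
  let ?s0 = "store i 0 0 s"
  have init: "exec_le (Assign i (Num 0) (Num 0)) s (3 * Suc M) ?s0"
    using exec_le_Assign[of L s "Num 0" "Num 0" M i] prems by (auto elim!: exec_le_mono)
  have s0: "?s0 x = s x" if "x \<in> insert ''n'' X" for x
    using that prems(1) by (intro store_other) auto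
  have M: "L + B + B * (n * ?r) \<le> M" using prems(7) by (simp add: algebra_simps)
  have "cells_below (L + B) ?s0" using prems by (intro cells_below_store) auto
  then have l: "exec_le (While ?b ?body) ?s0 ((n * ?r + 1) * ?k * Suc M) ((?f ^^ n) ?s0)"
      "cells_below (L + B + B * (n * ?r)) ((?f ^^ n) ?s0)"
    using loop[of ?s0 "L + B" n] s0 prems M by auto
  have "exec_le (compile (For i c)) s (3 * Suc M + (n * ?r + 1) * ?k * Suc M) (run n (For i c) s)"
    using exec_le_Seq[OF init l(1)] by simp
  moreover have "3 * Suc M + (n * ?r + 1) * ?k * Suc M \<le> poly (steps (For i c)) n * step_cost (For i c) * Suc M"
  proof -
    have "3 + (n * ?r + 1) * ?k \<le> (2 + n * ?r) * ?k" by (simp add: algebra_simps)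
    from mult_le_mono1[OF this, of "Suc M"] show ?thesis by (simp add: algebra_simps)
  qed
  moreover have "cells_below (L + B * poly (steps (For i c)) n) (run n (For i c) s)"
    using l(2) by (auto intro: cells_below_mono simp: algebra_simps)
  ultimately show ?case by (auto intro: exec_le_mono)
qed

lemma poly_nat_mono: "m \<le> n \<Longrightarrow> poly (q :: nat poly) m \<le> poly q n"
  by (induction q) (auto intro!: mult_le_mono add_mono)


section \<open>The density of paths and the charging argument\<close>

text \<open>All successors of a vertex lie in its own weak component, where the intree condition
  applies.\<close>

lemma inforest_single_valued:
  assumes "inforest V E"
  shows "single_valued E"
proof (rule single_valuedI)
  fix x y z assume e: "(x, y) \<in> E" "(x, z) \<in> E"
  have sub: "E \<subseteq> V \<times> V" using assms by (simp add: inforest_def dag_def)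
  define K where "K = weakly_linked V E `` {x}"
  have "K \<in> V // weakly_linked V E"
    unfolding K_def using e sub by (intro quotientI) blast
  then have "single_valued (E \<inter> K \<times> K)"
    using assms by (auto simp: inforest_def intree_def)
  moreover have "x \<in> K" "y \<in> K" "z \<in> K"
    using e sub by (auto simp: K_def weakly_linked_def)
  ultimately show "y = z" using e by (meson IntI SigmaI single_valuedD)
qed

text \<open>The last job to finish starts only when all others are finished, so an induction can
  remove it. Jobs of zero time are set aside beforehand: one of them may start exactly when the last
  long job ends, which would spoil this order.\<close>

lemma feasible_volume:
  assumes "finite X" "X \<subseteq> V" "feasible V E p S" "\<forall>j\<in>V. 0 \<le> p j"
    "\<forall>j\<in>X. S j + p j \<le> t" "0 \<le> t"
  shows "sum p X \<le> t"
proof -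
  have pos: "sum p Y \<le> t" if "finite Y" "Y \<subseteq> V" "\<forall>j\<in>Y. 0 < p j" "\<forall>j\<in>Y. S j + p j \<le> t" "0 \<le> t" for Y t
    using that
  proof (induction "card Y" arbitrary: Y t)
    case 0 then show ?case by simp
  next
    case (Suc m)
    have "Y \<noteq> {}" using Suc.hyps(2) by auto
    then obtain j where j: "j \<in> Y" "\<And>i. i \<in> Y \<Longrightarrow> S i + p i \<le> S j + p j"
      using Suc.prems(1) arg_min_if_finite[of Y "\<lambda>i. - (S i + p i)"]
        ex_is_arg_min_if_finite[of Y "\<lambda>i. - (S i + p i)"] by (fastforce simp: is_arg_min_linorder)
    have "S i + p i \<le> S j" if "i \<in> Y - {j}" for i
    proof -
      have "S i + p i \<le> S j \<or> S j + p j \<le> S i"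
        using assms(3) that j(1) Suc.prems(2) unfolding feasible_def by blast
      moreover have "0 < p i" "S i + p i \<le> S j + p j" using that Suc.prems j(2) by auto
      ultimately show ?thesis by linarith
    qed
    moreover have "0 \<le> S j" using assms(3) j(1) Suc.prems(2) by (auto simp: feasible_def)
    moreover have "m = card (Y - {j})" using Suc.hyps(2) j(1) by simp
    ultimately have "sum p (Y - {j}) \<le> S j"
      using Suc.prems by (intro Suc.hyps(1)) auto
    moreover have "sum p Y = p j + sum p (Y - {j})" using j(1) Suc.prems(1) by (simp add: sum.remove)
    ultimately show ?case using Suc.prems(4) j(1) by force
  qed
  have "sum p {j\<in>X. 0 < p j} \<le> t"
    using assms(2,5) by (intro pos) (auto simp: assms(1,6))
  moreover have "sum p X = sum p {j\<in>X. 0 < p j}"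
  proof (rule sum.mono_neutral_right[OF assms(1)])
    show "\<forall>j\<in>X - {j\<in>X. 0 < p j}. p j = 0"
    proof
      fix j assume "j \<in> X - {j\<in>X. 0 < p j}"
      then have "\<not> 0 < p j" "0 \<le> p j" using assms(2,4) by auto
      then show "p j = 0" by simp
    qed
  qed auto
  ultimately show ?thesis by simp
qed

section \<open>Paths along successors and their densities\<close>

locale or_inforest =
  fixes V :: "'a set" and E :: "('a \<times> 'a) set" and p w :: "'a \<Rightarrow> real" and nxt :: "'a \<Rightarrow> 'a"
  assumes finite_V: "finite V" and E_sub: "E \<subseteq> V \<times> V" and acyclic_E: "acyclic E"
    and edge_iff: "i \<in> V \<Longrightarrow> (i, j) \<in> E \<longleftrightarrow> nxt i = j \<and> j \<in> V"
    and p_nonneg: "j \<in> V \<Longrightarrow> 0 \<le> p j" and w_nonneg: "j \<in> V \<Longrightarrow> 0 \<le> w j"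
begin

definition available :: "'a set \<Rightarrow> 'a \<Rightarrow> bool" where
  "available D j \<longleftrightarrow> (\<forall>i. (i, j) \<notin> E) \<or> (\<exists>i\<in>D. (i, j) \<in> E)"

text \<open>\<open>nxt\<close> is total; at a job without successor its value lies outside
  \<open>V\<close>, which is how a walk reveals its end.\<close>

definition path :: "'a \<Rightarrow> nat \<Rightarrow> 'a set" where
  "path v l = (\<lambda>i. (nxt ^^ i) v) ` {..<l}"

text \<open>Availability is asked of the first job only, as each later one has a predecessor on the
  path.\<close>

definition free_path :: "'a set \<Rightarrow> 'a \<Rightarrow> nat \<Rightarrow> bool" where
  "free_path D v l \<longleftrightarrow> available D v \<and> path v l \<subseteq> V - D"

lemma nxt_trancl:
  assumes "i < j" "\<forall>k\<le>j. (nxt ^^ k) v \<in> V"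
  shows "((nxt ^^ i) v, (nxt ^^ j) v) \<in> E\<^sup>+"
  using assms
proof (induction j)
  case (Suc j)
  have "((nxt ^^ j) v, (nxt ^^ Suc j) v) \<in> E"
    using Suc.prems(2) by (subst edge_iff) (auto dest: spec[of _ "Suc j"])
  with Suc show ?case by (cases "i = j") (auto intro: trancl_into_trancl simp: less_Suc_eq)
qed simp

lemma path_inj:
  assumes "path v l \<subseteq> V"
  shows "inj_on (\<lambda>i. (nxt ^^ i) v) {..<l}"
proof (rule linorder_inj_onI)
  fix i j assume "i < j" "i \<in> {..<l}" "j \<in> {..<l}"
  then have "((nxt ^^ i) v, (nxt ^^ j) v) \<in> E\<^sup>+"
    using assms by (intro nxt_trancl) (auto simp: path_def)
  then show "(nxt ^^ i) v \<noteq> (nxt ^^ j) v" using acyclic_E by (auto simp: acyclic_def)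
qed auto

lemma path_length:
  assumes "path v l \<subseteq> V" shows "l \<le> card V"
  using card_inj_on_le[OF path_inj[OF assms] _ finite_V] assms by (auto simp: path_def)

lemma sum_path:
  assumes "path v l \<subseteq> V"
  shows "sum f (path v l) = (\<Sum>i<l. f ((nxt ^^ i) v))"
  unfolding path_def by (subst sum.reindex) (use path_inj[OF assms] in \<open>auto simp: path_def\<close>)

lemma minimal_element:
  assumes "X \<subseteq> V" "X \<noteq> {}"
  obtains v where "v \<in> X" "\<And>i. (i, v) \<in> E \<Longrightarrow> i \<notin> X"
proof -
  have "wf E" using finite_V E_sub acyclic_E finite_acyclic_wf finite_subset by blast
  with assms(2) obtain v where "v \<in> X" "\<And>i. (i, v) \<in> E \<Longrightarrow> i \<notin> X" by (metis wfE_min ex_in_conv)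
  then show ?thesis by (rule that)
qed

text \<open>A set that can be processed after \<open>D\<close> splits into vertex-disjoint paths starting at
  available jobs, because a job has only one successor. So some single path is at least as
  dense as the whole set.\<close>

lemma density_bound:
  assumes "X \<subseteq> V - D" "\<forall>j\<in>X. available D j \<or> (\<exists>i\<in>X. (i, j) \<in> E)"
    and best: "\<And>v l. free_path D v l \<Longrightarrow> 0 < l \<Longrightarrow> sum w (path v l) * a \<le> b * sum p (path v l)"
  shows "sum w X * a \<le> b * sum p X"
  using assms(1,2)
proof (induction "card X" arbitrary: X rule: less_induct)
  case less
  show ?case
  proof (cases "X = {}")
    case False
    have XV: "X \<subseteq> V" using less.prems by auto
    then have fin: "finite X" using finite_V finite_subset by blast
    \<comment> \<open>Having no predecessor in \<open>X\<close>, this job must itself be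
      available.\<close>
    obtain v where v: "v \<in> X" "\<And>i. (i, v) \<in> E \<Longrightarrow> i \<notin> X" using minimal_element[OF XV False] by blast
    have "\<exists>l. (nxt ^^ l) v \<notin> X"
    proof (rule ccontr)
      assume "\<not> ?thesis"
      then have "path v (Suc (card V)) \<subseteq> V" using XV by (auto simp: path_def)
      from path_length[OF this] show False by simp
    qed
    define l where "l = (LEAST l. (nxt ^^ l) v \<notin> X)"
    have l: "(nxt ^^ l) v \<notin> X" unfolding l_def by (rule LeastI_ex) fact
    have l_less: "(nxt ^^ i) v \<in> X" if "i < l" for i using not_less_Least[of i] that by (auto simp: l_def)
    have "0 < l" using l v(1) by (cases l) auto
    have pX: "path v l \<subseteq> X" using l_less by (auto simp: path_def)
    have "v \<in> path v l" using \<open>0 < l\<close> by (auto simp: path_def intro: image_eqI[of _ _ 0])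
    have "free_path D v l" using pX less.prems v by (auto simp: free_path_def)
    note b1 = best[OF this \<open>0 < l\<close>]
    have b2: "sum w (X - path v l) * a \<le> b * sum p (X - path v l)"
    proof (rule less.hyps)
      show "card (X - path v l) < card X"
        using fin v(1) \<open>v \<in> path v l\<close> by (intro psubset_card_mono) auto
      show "X - path v l \<subseteq> V - D" using less.prems by auto
      show "\<forall>j\<in>X - path v l. available D j \<or> (\<exists>i\<in>X - path v l. (i, j) \<in> E)"
      proof
        fix j assume j: "j \<in> X - path v l"
        \<comment> \<open>Removing the path takes no predecessor from the rest: the single successor
          of a path job is the next path job or, at the end, lies outside \<open>X\<close>.\<close>
        have "i \<notin> path v l" if "(i, j) \<in> E" "i \<in> X" for i
        proof
          assume "i \<in> path v l"
          then obtain m where m: "m < l" "i = (nxt ^^ m) v" by (auto simp: path_def)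
          have "j = (nxt ^^ Suc m) v" using that m edge_iff XV by auto
          have "Suc m \<noteq> l" using \<open>j = _\<close> j l by auto
          then have "j \<in> path v l" unfolding path_def \<open>j = _\<close> using m(1) by (intro imageI) auto
          then show False using j by simp
        qed
        then show "available D j \<or> (\<exists>i\<in>X - path v l. (i, j) \<in> E)" using j less.prems(2) by blast
      qed
    qed
    have "sum f X = sum f (path v l) + sum f (X - path v l)" for f :: "'a \<Rightarrow> real"
      using fin pX by (metis sum.subset_diff add.commute)
    then show ?thesis using b1 b2 by (simp add: algebra_simps)
  qed simp
qed

section \<open>Partial schedules and the charging invariant\<close>

definition valid_partial :: "'a set \<Rightarrow> ('a \<Rightarrow> real) \<Rightarrow> real \<Rightarrow> bool" where
  "valid_partial D S T \<longleftrightarrow> D \<subseteq> V \<and> 0 \<le> T \<and> (\<forall>j\<in>D. 0 \<le> S j \<and> S j + p j \<le> T) \<and>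
     (\<forall>i\<in>D. \<forall>j\<in>D. i \<noteq> j \<longrightarrow> S i + p i \<le> S j \<or> S j + p j \<le> S i) \<and>
     (\<forall>j\<in>D. (\<exists>i. (i, j) \<in> E) \<longrightarrow> (\<exists>i\<in>D. (i, j) \<in> E \<and> S i + p i \<le> S j))"

lemma valid_partial_feasible: "valid_partial V S T \<Longrightarrow> feasible V E p S"
  unfolding valid_partial_def feasible_def by blast

lemma valid_partial_insert:
  assumes "valid_partial D S T" "u \<in> V - D" "available D u"
  shows "valid_partial (insert u D) (S(u := T)) (T + p u)"
proof -
  note vp = assms(1)[unfolded valid_partial_def]
  have pu: "0 \<le> p u" using assms(2) p_nonneg by auto
  have u: "i \<noteq> u" if "i \<in> D" for i using that assms(2) by auto
  have 1: "\<forall>j\<in>insert u D. (\<exists>i. (i, j) \<in> E) \<longrightarrow>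
      (\<exists>i\<in>insert u D. (i, j) \<in> E \<and> (S(u := T)) i + p i \<le> (S(u := T)) j)"
  proof (intro ballI impI)
    fix j assume j: "j \<in> insert u D" and e: "\<exists>i. (i, j) \<in> E"
    show "\<exists>i\<in>insert u D. (i, j) \<in> E \<and> (S(u := T)) i + p i \<le> (S(u := T)) j"
    proof (cases "j = u")
      case True
      then obtain i where "i \<in> D" "(i, u) \<in> E" using assms(3) e by (auto simp: available_def)
      then show ?thesis using True vp u by (intro bexI[of _ i]) auto
    next
      case False
      then obtain i where "i \<in> D" "(i, j) \<in> E" "S i + p i \<le> S j" using vp j e by blast
      then show ?thesis using False u by (intro bexI[of _ i]) auto
    qed
  qed
  have 2: "\<forall>j\<in>insert u D. 0 \<le> (S(u := T)) j \<and> (S(u := T)) j + p j \<le> T + p u"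
    using vp pu by fastforce
  have 3: "\<forall>i\<in>insert u D. \<forall>j\<in>insert u D. i \<noteq> j \<longrightarrow>
     (S(u := T)) i + p i \<le> (S(u := T)) j \<or> (S(u := T)) j + p j \<le> (S(u := T)) i"
    using vp by auto
  show ?thesis unfolding valid_partial_def
    using 1 2 3 vp pu assms(2) by (intro conjI) auto
qed

text \<open>The invariant behind the factor 4. In the histogram argument of Feige, Lovasz and Tetali,
  the greedy histogram, shrunk by the factor 2 in both directions, fits under the histogram of
  any feasible schedule; \<open>h\<close> is the height up to which the latter has been used so far.\<close>

definition charged :: "'a set \<Rightarrow> ('a \<Rightarrow> real) \<Rightarrow> real \<Rightarrow> bool" where
  "charged D S T \<longleftrightarrow> (\<forall>S'. feasible V E p S' \<longrightarrow> (\<exists>h\<ge>0.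
     ((\<Sum>j\<in>D. w j * (S j + p j)) + sum w (V - D) * T) / 4 + sum w (V - D) / 2 * h
       \<le> (\<Sum>j\<in>V. w j * min (S' j + p j) h)))"

lemma charged_empty: "charged {} S 0"
proof -
  have "\<exists>h\<ge>0. 0 + sum w V / 2 * h \<le> (\<Sum>j\<in>V. w j * min (S' j + p j) h)"
    if "feasible V E p S'" for S'
    using that p_nonneg by (intro exI[of _ 0]) (auto simp: feasible_def min_def w_nonneg intro!: sum_nonneg mult_nonneg_nonneg)
  then show ?thesis by (simp add: charged_def)
qed

lemma charged_objective:
  assumes "charged V S T" "feasible V E p S'"
  shows "objective V p w S \<le> 4 * objective V p w S'"
proof -
  obtain h where "objective V p w S / 4 \<le> (\<Sum>j\<in>V. w j * min (S' j + p j) h)"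
    using assms by (auto simp: charged_def objective_def)
  also have "\<dots> \<le> objective V p w S'"
    unfolding objective_def using w_nonneg by (intro sum_mono mult_left_mono) auto
  finally show ?thesis by simp
qed

text \<open>The jobs outside \<open>D\<close> that \<open>S'\<close> completes by time
  \<open>t\<close> form a set as in \<open>density_bound\<close>, because their earliest-needed
  predecessors complete by \<open>t\<close> too. They occupy the machine for at most
  \<open>t\<close>, so their weight is at most \<open>t\<close> times the density b / a.\<close>

lemma late_weight:
  assumes S: "feasible V E p S'" and "D \<subseteq> V" "0 \<le> t" "0 \<le> b"
    and best: "\<And>v l. free_path D v l \<Longrightarrow> 0 < l \<Longrightarrow> sum w (path v l) * a \<le> b * sum p (path v l)"
    and a: "0 \<le> a"
  shows "(sum w (V - D) - sum w {j\<in>V. t < S' j + p j}) * a \<le> b * t"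
proof -
  define X where "X = {j\<in>V - D. S' j + p j \<le> t}"
  have "sum w X * a \<le> b * sum p X"
  proof (rule density_bound[OF _ _ best])
    show "\<forall>j\<in>X. available D j \<or> (\<exists>i\<in>X. (i, j) \<in> E)"
    proof
      fix j assume j: "j \<in> X"
      show "available D j \<or> (\<exists>i\<in>X. (i, j) \<in> E)"
      proof (cases "\<exists>i. (i, j) \<in> E")
        case True
        then obtain i where i: "(i, j) \<in> E" "S' i + p i \<le> S' j"
          using S j by (auto simp: feasible_def X_def)
        have "0 \<le> p j" using j p_nonneg by (auto simp: X_def)
        then have "i \<in> D \<or> i \<in> X" using i j E_sub by (auto simp: X_def)
        then show ?thesis using i by (auto simp: available_def)
      qed (simp add: available_def)
    qed
  qed (auto simp: X_def)
  also have "sum p X \<le> t"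
    using finite_V S p_nonneg assms(3) by (intro feasible_volume[of X V E p S']) (auto simp: X_def)
  finally have "sum w X * a \<le> b * t" using assms(4) by (simp add: mult_left_mono)
  moreover have "sum w (V - D) \<le> sum w (X \<union> {j\<in>V. t < S' j + p j})"
    using finite_V w_nonneg by (intro sum_mono2) (auto simp: X_def)
  moreover have "sum w (X \<union> {j\<in>V. t < S' j + p j}) = sum w X + sum w {j\<in>V. t < S' j + p j}"
    using finite_V by (intro sum.union_disjoint) (auto simp: X_def)
  ultimately show ?thesis using a by (smt (verit) mult_right_mono)
qed

text \<open>Jobs completed after \<open>h'\<close> fill the whole layer of the histogram between
  \<open>h\<close> and \<open>h'\<close>.\<close>

lemma raise_height:
  assumes "h \<le> h'"
  shows "(\<Sum>j\<in>V. w j * min (c j) h) + sum w {j\<in>V. h' < c j} * (h' - h) \<le> (\<Sum>j\<in>V. w j * min (c j) h')"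
proof -
  have "sum w {j\<in>V. h' < c j} * (h' - h) = (\<Sum>j\<in>V. if h' < c j then w j * (h' - h) else 0)"
    using finite_V by (simp add: sum_distrib_right sum.inter_filter if_distrib[of "\<lambda>x. x * (h' - h)"] cong: if_cong)
  then have "(\<Sum>j\<in>V. w j * min (c j) h) + sum w {j\<in>V. h' < c j} * (h' - h) =
     (\<Sum>j\<in>V. w j * min (c j) h + (if h' < c j then w j * (h' - h) else 0))"
    by (simp add: sum.distrib)
  also have "\<dots> \<le> (\<Sum>j\<in>V. w j * min (c j) h')"
  proof (rule sum_mono)
    fix j assume "j \<in> V"
    then have "w j * (min (c j) h + (if h' < c j then h' - h else 0)) \<le> w j * min (c j) h'"
      using assms w_nonneg by (intro mult_left_mono) auto
    then show "w j * min (c j) h + (if h' < c j then w j * (h' - h) else 0) \<le> w j * min (c j) h'"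
      by (auto simp: algebra_simps split: if_splits)
  qed
  finally show ?thesis .
qed

text \<open>In the invariant, \<open>(G + R * T) / 4\<close> bounds the area of the halved greedy
  columns so far, \<open>R / 2 * h\<close> is a rectangle reserved for the remaining ones, and
  \<open>Q h\<close> is the area of the histogram of \<open>S'\<close> below height
  \<open>h\<close>. The new column has height \<open>t\<close>. If \<open>t \<le> h\<close>, it fits
  into the reserved rectangle; otherwise the height is raised to \<open>t\<close>, and late weight
  of at least \<open>R / 2\<close> gives the layer enough width.\<close>

lemma charged_step:
  assumes "charged D S T" "D \<subseteq> V" "B \<subseteq> V - D"
    and best: "\<And>v l. free_path D v l \<Longrightarrow> 0 < l \<Longrightarrow> sum w (path v l) * sum p B \<le> sum w B * sum p (path v l)"
    and S1: "\<forall>j\<in>D. S1 j = S j" "\<forall>j\<in>B. S1 j + p j \<le> T + sum p B"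
  shows "charged (D \<union> B) S1 (T + sum p B)"
  unfolding charged_def
proof (intro allI impI)
  fix S' assume S': "feasible V E p S'"
  define R where "R = sum w (V - D)"
  define R' where "R' = sum w (V - (D \<union> B))"
  define a where "a = sum p B"
  define b where "b = sum w B"
  define G where "G = (\<Sum>j\<in>D. w j * (S j + p j))"
  define G' where "G' = (\<Sum>j\<in>D \<union> B. w j * (S1 j + p j))"
  define Q where "Q = (\<lambda>h. \<Sum>j\<in>V. w j * min (S' j + p j) h)"
  have fin: "finite D" "finite B" using assms finite_V finite_subset by blast+
  have R: "R = b + R'"
  proof -
    have "V - D = B \<union> (V - (D \<union> B))" using assms by auto
    then show ?thesis unfolding R_def R'_def b_def using finite_V fin
      by (metis Diff_disjoint Diff_Un Int_assoc Un_Int_eq(1) finite_Diff inf_bot_right inf_commute sum.union_disjoint sup_commute Un_Diff_Int Diff_Diff_Int)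
  qed
  have nn: "0 \<le> a" "0 \<le> b" "0 \<le> R'" "0 \<le> R"
    unfolding a_def b_def R'_def R_def using assms p_nonneg w_nonneg by (auto intro!: sum_nonneg)
  have "G' = G + (\<Sum>j\<in>B. w j * (S1 j + p j))"
    unfolding G'_def G_def using fin S1(1) assms(3) by (subst sum.union_disjoint) auto
  also have "(\<Sum>j\<in>B. w j * (S1 j + p j)) \<le> (\<Sum>j\<in>B. w j * (T + a))"
    using S1(2) w_nonneg assms(3) by (intro sum_mono mult_left_mono) (auto simp: a_def)
  also have "\<dots> = b * (T + a)" by (simp add: b_def sum_distrib_right)
  finally have G': "G' + R' * (T + a) \<le> G + R * T + R * a"
    by (simp add: R algebra_simps)
  obtain h where h: "0 \<le> h" "(G + R * T) / 4 + R / 2 * h \<le> Q h"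
    using assms(1) S' unfolding charged_def G_def R_def Q_def by blast
  have late: "(R - sum w {j\<in>V. t < S' j + p j}) * a \<le> b * t" if "0 \<le> t" for t
    unfolding R_def a_def b_def using nn that by (intro late_weight[OF S' assms(2)] best) (auto simp: a_def b_def)
  have "\<exists>h'\<ge>0. R * a / 4 + R' / 2 * h' + Q h \<le> Q h' + R / 2 * h"
  proof (cases "R * a = 0")
    case True
    have "R' * h \<le> R * h" using nn h by (intro mult_right_mono) (auto simp: R)
    then show ?thesis using h True by (intro exI[of _ h]) auto
  next
    case False
    then have pos: "0 < R" "0 < a" using nn by auto
    have "0 < b"
    proof (rule ccontr)
      assume "\<not> 0 < b"
      then have b0: "b = 0" using nn by simp
      \<comment> \<open>A time by which \<open>S'\<close> has finished everything: a chosen path of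
        weight 0 would force \<open>R * a \<le> 0\<close>.\<close>
      define t where "t = (\<Sum>j\<in>V. S' j + p j)"
      have t: "S' j + p j \<le> t" "0 \<le> S' j + p j" if "j \<in> V" for j
      proof -
        show "0 \<le> S' j + p j" using that S' p_nonneg by (auto simp: feasible_def)
        show "S' j + p j \<le> t" unfolding t_def using that S' p_nonneg finite_V
          by (intro member_le_sum) (auto simp: feasible_def)
      qed
      then have "{j\<in>V. t < S' j + p j} = {}" by force
      moreover have "0 \<le> t" unfolding t_def using t by (intro sum_nonneg) auto
      ultimately have "R * a \<le> 0" using late[of t] b0 by (metis diff_zero mult_zero_left sum.empty)
      then show False using pos by (simp add: mult_le_0_iff)
    qed
    define t where "t = R * a / (2 * b)"
    have "0 \<le> t" using pos \<open>0 < b\<close> by (simp add: t_def)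
    have "b * t = R / 2 * a" using \<open>0 < b\<close> by (simp add: t_def)
    then have "R - sum w {j\<in>V. t < S' j + p j} \<le> R / 2"
      using late[OF \<open>0 \<le> t\<close>] pos(2) by (metis mult_right_le_imp_le)
    then have lw: "R / 2 \<le> sum w {j\<in>V. t < S' j + p j}" by simp
    \<comment> \<open>The area of the halved column, of width \<open>b / 2\<close> and height
      \<open>t\<close>.\<close>
    have Ra: "R * a / 4 = (R - R') / 2 * t" using \<open>0 < b\<close> by (simp add: R t_def)
    show ?thesis
    proof (cases "t \<le> h")
      case True
      have "(R - R') / 2 * t \<le> (R - R') / 2 * h" using True nn by (intro mult_left_mono) (auto simp: R)
      then have "R * a / 4 + R' / 2 * h \<le> R / 2 * h" unfolding Ra by (simp add: field_simps)
      then show ?thesis using h by (intro exI[of _ h]) auto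
    next
      case False
      have "Q h + R / 2 * (t - h) \<le> Q h + sum w {j\<in>V. t < S' j + p j} * (t - h)"
        using lw False by (intro add_left_mono mult_right_mono) auto
      also have "\<dots> \<le> Q t" unfolding Q_def using False by (intro raise_height) auto
      finally have "(R - R') / 2 * t + R' / 2 * t + Q h \<le> Q t + R / 2 * h"
        by (simp add: field_simps)
      then show ?thesis using \<open>0 \<le> t\<close> unfolding Ra by (intro exI[of _ t]) auto
    qed
  qed
  then obtain h' where "0 \<le> h'" "R * a / 4 + R' / 2 * h' + Q h \<le> Q h' + R / 2 * h" by blast
  moreover have "x' / 4 + y' \<le> q'" if "x' \<le> x + z" "z / 4 + y' + q \<le> q' + y" "x / 4 + y \<le> q"
    for x x' y y' z q q' :: real
    using that by linarith
  ultimately have "0 \<le> h'" "(G' + R' * (T + a)) / 4 + R' / 2 * h' \<le> Q h'"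
    using h(2) G' by blast+
  then show "\<exists>h\<ge>0. ((\<Sum>j\<in>D \<union> B. w j * (S1 j + p j)) + sum w (V - (D \<union> B)) * (T + sum p B)) / 4 +
      sum w (V - (D \<union> B)) / 2 * h \<le> (\<Sum>j\<in>V. w j * min (S' j + p j) h)"
    using \<open>0 \<le> h'\<close> by (auto simp: G'_def R'_def a_def Q_def)
qed

end


section \<open>The greedy program\<close>

declare run.simps(4) [simp del]

text \<open>\<open>P\<close> and \<open>W\<close> are the processing times and weights scaled to common denominators. Array
  \<open>next\<close> holds the successor of each job, or \<open>n\<close> if there is none; the sentinel \<open>n\<close>
  is marked as done. \<open>free\<close> marks the jobs without unfulfilled precedence constraint. \<open>bv\<close>,
  \<open>bl\<close>, \<open>bp\<close> and \<open>bw\<close> are the first job, the length, the processing time and the weight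
  of the densest path found so far, where \<open>bl = 0\<close> means that there is none.\<close>

definition prepare_numbers :: loop_prog where
  "prepare_numbers =
     For ''j'' (
       Put ''P'' (var ''j'') (Cell ''p_num'' (var ''j'')) ;;
       Put ''W'' (var ''j'') (Cell ''w_num'' (var ''j'')) ;;
       Put ''S_den'' (var ''j'') (Num 1) ;;
       For ''k'' (
         When (Add (Sub (var ''k'') (var ''j'')) (Sub (var ''j'') (var ''k''))) (
           Put ''P'' (var ''j'') (Mult (Cell ''P'' (var ''j'')) (Cell ''p_den'' (var ''k''))) ;;
           Put ''W'' (var ''j'') (Mult (Cell ''W'' (var ''j'')) (Cell ''w_den'' (var ''k'')))) ;;
         Put ''S_den'' (var ''j'') (Mult (Cell ''S_den'' (var ''j'')) (Cell ''p_den'' (var ''k'')))))"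

definition prepare_graph :: loop_prog where
  "prepare_graph =
     For ''j'' (Put ''next'' (var ''j'') (var ''n'') ;; Put ''free'' (var ''j'') (Num 1)) ;;
     Put ''done'' (var ''n'') (Num 1) ;;
     For ''j'' (For ''k'' (
       When (Cell ''adj'' (Add (Mult (var ''j'') (var ''n'')) (var ''k''))) (
         Put ''next'' (var ''j'') (var ''k'') ;; Put ''free'' (var ''k'') (Num 0))))"

text \<open>Truncated subtraction acts as comparison: the first summand is nonzero if no path has
  been found yet, the second if the new path is strictly denser.\<close>

definition consider_path :: loop_prog where
  "consider_path =
     When (Add (Sub (Num 1) (var ''bl''))
           (Sub (Mult (var ''sw'') (var ''bp'')) (Mult (var ''bw'') (var ''sp'')))) (
       Put ''bv'' (Num 0) (var ''v'') ;;
       Put ''bl'' (Num 0) (Add (var ''l'') (Num 1)) ;;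
       Put ''bp'' (Num 0) (var ''sp'') ;;
       Put ''bw'' (Num 0) (var ''sw''))"

text \<open>A loop cannot be left early. Instead \<open>u\<close> stops at the first done job,
  possibly the sentinel, and the remaining iterations idle.\<close>

definition extend_path :: loop_prog where
  "extend_path =
     When (Sub (Num 1) (Cell ''done'' (var ''u''))) (
       Put ''sp'' (Num 0) (Add (var ''sp'') (Cell ''P'' (var ''u''))) ;;
       Put ''sw'' (Num 0) (Add (var ''sw'') (Cell ''W'' (var ''u''))) ;;
       consider_path ;;
       Put ''u'' (Num 0) (Cell ''next'' (var ''u'')))"

text \<open>Resetting \<open>bl\<close> suffices, since \<open>consider_path\<close> accepts any
  path while \<open>bl\<close> is 0.\<close>

definition search :: loop_prog where
  "search =
     Put ''bl'' (Num 0) (Num 0) ;;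
     For ''v'' (When (Cell ''free'' (var ''v'')) (
       Put ''u'' (Num 0) (var ''v'') ;;
       Put ''sp'' (Num 0) (Num 0) ;;
       Put ''sw'' (Num 0) (Num 0) ;;
       For ''l'' extend_path))"

text \<open>Marks in \<open>free\<close> are never withdrawn; a scheduled job is kept out of later
  paths by its mark in \<open>done\<close>.\<close>

definition schedule_path :: loop_prog where
  "schedule_path =
     Put ''u'' (Num 0) (var ''bv'') ;;
     For ''l'' (When (Sub (var ''bl'') (var ''l'')) (
       Put ''S_num'' (var ''u'') (var ''T'') ;;
       Put ''T'' (Num 0) (Add (var ''T'') (Cell ''P'' (var ''u''))) ;;
       Put ''done'' (var ''u'') (Num 1) ;;
       Put ''free'' (Cell ''next'' (var ''u'')) (Num 1) ;;
       Put ''u'' (Num 0) (Cell ''next'' (var ''u''))))"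

definition greedy :: loop_prog where
  "greedy = prepare_numbers ;; prepare_graph ;; For ''r'' (search ;; schedule_path)"

lemma well_formed_greedy: "well_formed {''p_den'', ''w_den''} greedy"
  by (simp add: greedy_def prepare_numbers_def prepare_graph_def consider_path_def extend_path_def
      search_def schedule_path_def)

section \<open>Effect of the preparation\<close>

definition others_product :: "(nat \<Rightarrow> nat) \<Rightarrow> nat \<Rightarrow> nat \<Rightarrow> nat" where
  "others_product f j k = prod f ({..<k} - {j})"

lemma others_product_simps [simp]:
  "others_product f j 0 = 1"
  "others_product f j (Suc k) = (if k = j then others_product f j k else others_product f j k * f k)"
  by (auto simp: others_product_def lessThan_Suc insert_Diff_if)

lemma others_product: "j < n \<Longrightarrow> f j * others_product f j n = prod f {..<n}"
  unfolding others_product_def by (subst prod.remove[of _ j]) auto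

text \<open>Multiplying a numerator by the denominators of all other jobs brings it over the product
  of all denominators, without division and with an input number as second factor each time.\<close>

lemma run_prepare_numbers:
  fixes s :: memory
  assumes "j < n"
  defines "s' \<equiv> run n prepare_numbers s"
  shows "s' ''P'' j = s ''p_num'' j * others_product (s ''p_den'') j n"
    "s' ''W'' j = s ''w_num'' j * others_product (s ''w_den'') j n"
    "s' ''S_den'' j = prod (s ''p_den'') {..<n}"
proof -
  define num_inv where "num_inv = (\<lambda>j k s'. (\<forall>x\<in>{''p_num'', ''p_den'', ''w_num'', ''w_den''}. s' x = s x) \<and>
     s' ''P'' j = s ''p_num'' j * others_product (s ''p_den'') j k \<and>
     s' ''W'' j = s ''w_num'' j * others_product (s ''w_den'') j k \<and>
     s' ''S_den'' j = prod (s ''p_den'') {..<k})"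
  define inv where "inv = (\<lambda>m (s'::memory). (\<forall>x\<in>{''p_num'', ''p_den'', ''w_num'', ''w_den''}. s' x = s x) \<and>
     (\<forall>j<m. num_inv j n s'))"
  have "inv n (run n prepare_numbers s)"
    unfolding prepare_numbers_def
  proof (rule run_For_invariant)
    show "inv 0 (store ''j'' 0 0 s)" by (simp add: inv_def store_def)
  next
    fix m s1 assume m: "m < n" "s1 ''j'' 0 = m" "inv m s1"
    define s2 where "s2 = store ''S_den'' m 1 (store ''W'' m (s1 ''w_num'' m) (store ''P'' m (s1 ''p_num'' m) s1))"
    \<comment> \<open>With truncated subtraction the condition is nonzero exactly if
      \<open>k\<close> differs from \<open>j\<close>.\<close>
    let ?body = "When (Add (Sub (var ''k'') (var ''j'')) (Sub (var ''j'') (var ''k''))) (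
           Put ''P'' (var ''j'') (Mult (Cell ''P'' (var ''j'')) (Cell ''p_den'' (var ''k''))) ;;
           Put ''W'' (var ''j'') (Mult (Cell ''W'' (var ''j'')) (Cell ''w_den'' (var ''k'')))) ;;
         Put ''S_den'' (var ''j'') (Mult (Cell ''S_den'' (var ''j'')) (Cell ''p_den'' (var ''k'')))"
    have s2: "s2 ''j'' 0 = m" "\<forall>j<m. num_inv j n s2" "num_inv m 0 s2"
      using m by (auto simp: s2_def store_def inv_def num_inv_def)
    have "(\<lambda>k s'. s' ''j'' 0 = m \<and> (\<forall>j<m. num_inv j n s') \<and> num_inv m k s') n (run n (For ''k'' ?body) s2)"
    proof (rule run_For_invariant[where I = "\<lambda>k s'. s' ''j'' 0 = m \<and> (\<forall>j<m. num_inv j n s') \<and> num_inv m k s'"])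
      show "store ''k'' 0 0 s2 ''j'' 0 = m \<and> (\<forall>j<m. num_inv j n (store ''k'' 0 0 s2)) \<and>
          num_inv m 0 (store ''k'' 0 0 s2)"
        using s2 by (simp add: num_inv_def store_def)
    next
      fix k s3 assume k: "k < n" "s3 ''k'' 0 = k" "s3 ''j'' 0 = m \<and> (\<forall>j<m. num_inv j n s3) \<and> num_inv m k s3"
      then have old: "num_inv j n s3" if "j < m" for j using that by simp
      have cur: "num_inv m k s3" "s3 ''j'' 0 = m" using k by auto
      have "num_inv j n (store ''k'' 0 (Suc k) (run n ?body s3))" if "j < m" for j
        using old[OF that] that k(2) cur(2) by (cases "k = m") (simp_all add: num_inv_def store_def)
      moreover have "num_inv m (Suc k) (store ''k'' 0 (Suc k) (run n ?body s3))"
        using cur k(2) by (cases "k = m") (simp_all add: num_inv_def store_def lessThan_Suc)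
      moreover have "store ''k'' 0 (Suc k) (run n ?body s3) ''j'' 0 = m"
        using cur(2) by (simp add: store_def)
      ultimately show "store ''k'' 0 (Suc k) (run n ?body s3) ''j'' 0 = m \<and>
          (\<forall>j<m. num_inv j n (store ''k'' 0 (Suc k) (run n ?body s3))) \<and>
          num_inv m (Suc k) (store ''k'' 0 (Suc k) (run n ?body s3))" by blast
    qed simp
    then have "inv (Suc m) (store ''j'' 0 (Suc m) (run n (For ''k'' ?body) s2))"
      by (auto simp: inv_def num_inv_def store_def less_Suc_eq)
    then show "inv (Suc m) (store ''j'' 0 (Suc m) (run n (
       Put ''P'' (var ''j'') (Cell ''p_num'' (var ''j'')) ;;
       Put ''W'' (var ''j'') (Cell ''w_num'' (var ''j'')) ;;
       Put ''S_den'' (var ''j'') (Num 1) ;; For ''k'' ?body) s1))"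
      using m by (simp add: s2_def store_other)
  qed simp
  then show "s' ''P'' j = s ''p_num'' j * others_product (s ''p_den'') j n"
    "s' ''W'' j = s ''w_num'' j * others_product (s ''w_den'') j n"
    "s' ''S_den'' j = prod (s ''p_den'') {..<n}"
    using assms(1) by (auto simp: s'_def inv_def num_inv_def)
qed

text \<open>For an arbitrary matrix \<open>next\<close> is merely some successor; that it is the
  only one is added in \<open>greedy_correct\<close>.\<close>

lemma run_prepare_graph:
  fixes s :: memory
  assumes "s ''n'' 0 = n" "\<forall>i. s ''done'' i = 0"
  defines "s' \<equiv> run n prepare_graph s"
  shows "i < n \<Longrightarrow> (\<exists>j<n. s ''adj'' (i * n + j) \<noteq> 0 \<and> s' ''next'' i = j) \<or>
      (\<forall>j<n. s ''adj'' (i * n + j) = 0) \<and> s' ''next'' i = n"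
    "j < n \<Longrightarrow> s' ''free'' j \<noteq> 0 \<longleftrightarrow> (\<forall>i<n. s ''adj'' (i * n + j) = 0)"
    "s' ''done'' = (\<lambda>i. if i = n then 1 else 0)"
proof -
  \<comment> \<open>The edges met before position \<open>(i, m)\<close> of the row-major
    scan.\<close>
  define A where "A = (\<lambda>i m. {(i', j). i' < n \<and> j < n \<and> s ''adj'' (i' * n + j) \<noteq> 0 \<and> (i' < i \<or> i' = i \<and> j < m)})"
  define inv where "inv = (\<lambda>A (s'::memory). s' ''n'' 0 = n \<and> s' ''adj'' = s ''adj'' \<and>
    s' ''done'' = (\<lambda>i. if i = n then 1 else 0) \<and>
    (\<forall>i<n. (i, s' ''next'' i) \<in> A \<or> (\<forall>j. (i, j) \<notin> A) \<and> s' ''next'' i = n) \<and>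
    (\<forall>j<n. s' ''free'' j \<noteq> 0 \<longleftrightarrow> (\<forall>i. (i, j) \<notin> A)))"
  define s1 where "s1 = run n (For ''j'' (Put ''next'' (var ''j'') (var ''n'') ;; Put ''free'' (var ''j'') (Num 1))) s"
  have "s1 ''n'' 0 = n \<and> s1 ''done'' = s ''done'' \<and> s1 ''adj'' = s ''adj'' \<and>
      (\<forall>j<n. s1 ''next'' j = n \<and> s1 ''free'' j = 1)" (is "?I n s1")
    unfolding s1_def
    by (rule run_For_invariant[where I = "\<lambda>m s'. s' ''n'' 0 = n \<and> s' ''done'' = s ''done'' \<and>
        s' ''adj'' = s ''adj'' \<and> (\<forall>j<m. s' ''next'' j = n \<and> s' ''free'' j = 1)"])
      (use assms in \<open>auto simp: store_def less_Suc_eq\<close>)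
  then have s2: "inv {} (store ''done'' n 1 s1)" "s1 ''n'' 0 = n"
    using assms(2) by (auto simp: inv_def store_def)
  let ?body = "When (Cell ''adj'' (Add (Mult (var ''j'') (var ''n'')) (var ''k''))) (
         Put ''next'' (var ''j'') (var ''k'') ;; Put ''free'' (var ''k'') (Num 0))"
  have row: "inv (A i n) (run n (For ''k'' ?body) s2) \<and> run n (For ''k'' ?body) s2 ''j'' 0 = i"
    if "i < n" "inv (A i 0) s2" "s2 ''j'' 0 = i" for i s2
  proof (rule run_For_invariant[where I = "\<lambda>k s'. inv (A i k) s' \<and> s' ''j'' 0 = i"])
    show "inv (A i 0) (store ''k'' 0 0 s2) \<and> store ''k'' 0 0 s2 ''j'' 0 = i"
      using that by (simp add: inv_def store_def)
  next
    fix k s3 assume k: "k < n" "s3 ''k'' 0 = k" "inv (A i k) s3 \<and> s3 ''j'' 0 = i"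
    then have n: "s3 ''n'' 0 = n" "s3 ''adj'' = s ''adj''" by (auto simp: inv_def)
    show "inv (A i (Suc k)) (store ''k'' 0 (Suc k) (run n ?body s3)) \<and>
        store ''k'' 0 (Suc k) (run n ?body s3) ''j'' 0 = i"
    proof (cases "s ''adj'' (i * n + k) = 0")
      case True
      then have "A i (Suc k) = A i k" by (auto simp: A_def less_Suc_eq)
      then show ?thesis using True k n by (simp add: inv_def store_def)
    next
      case False
      then have A: "A i (Suc k) = insert (i, k) (A i k)" using k(1) that(1) by (auto simp: A_def less_Suc_eq)
      have "inv (insert (i, k) (A i k)) (store ''k'' 0 (Suc k) (store ''free'' k 0 (store ''next'' i k s3)))"
        using k by (auto simp: inv_def store_def)
      then show ?thesis using False k n unfolding A by (simp add: store_def)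
    qed
  qed simp
  have "inv (A n 0) (run n (For ''j'' (For ''k'' ?body)) (store ''done'' n 1 s1))"
  proof (rule run_For_invariant)
    have "A 0 0 = {}" by (auto simp: A_def)
    then show "inv (A 0 0) (store ''j'' 0 0 (store ''done'' n 1 s1))"
      using s2 by (simp add: inv_def store_def)
  next
    fix i s3 assume "i < n" "s3 ''j'' 0 = i" "inv (A i 0) s3"
    with row[of i s3] have "inv (A i n) (run n (For ''k'' ?body) s3)" by simp
    moreover have "A (Suc i) 0 = A i n" by (auto simp: A_def less_Suc_eq)
    ultimately show "inv (A (Suc i) 0) (store ''j'' 0 (Suc i) (run n (For ''k'' ?body) s3))"
      by (simp add: inv_def store_def)
  qed simp
  then have "inv (A n 0) s'"
    using s2(2) by (simp add: s'_def prepare_graph_def s1_def)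
  then show "i < n \<Longrightarrow> (\<exists>j<n. s ''adj'' (i * n + j) \<noteq> 0 \<and> s' ''next'' i = j) \<or>
      (\<forall>j<n. s ''adj'' (i * n + j) = 0) \<and> s' ''next'' i = n"
    "j < n \<Longrightarrow> s' ''free'' j \<noteq> 0 \<longleftrightarrow> (\<forall>i<n. s ''adj'' (i * n + j) = 0)"
    "s' ''done'' = (\<lambda>i. if i = n then 1 else 0)"
    by (auto simp: inv_def A_def)
qed

section \<open>Search for a densest path\<close>

definition path_total :: "(nat \<Rightarrow> nat) \<Rightarrow> (nat \<Rightarrow> nat) \<Rightarrow> nat \<Rightarrow> nat \<Rightarrow> nat" where
  "path_total f nxt v l = (\<Sum>i<l. f ((nxt ^^ i) v))"

text \<open>The counterpart of \<open>free_path\<close> that the program can test. The walk is not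
  compared with \<open>n\<close>; the mark on the sentinel ends it.\<close>

definition candidate :: "memory \<Rightarrow> nat \<Rightarrow> nat \<Rightarrow> bool" where
  "candidate s v l \<longleftrightarrow> s ''free'' v \<noteq> 0 \<and> (\<forall>i<l. s ''done'' ((s ''next'' ^^ i) v) = 0) \<and> 0 < l"

definition best_of :: "(nat \<times> nat) set \<Rightarrow> memory \<Rightarrow> bool" where
  "best_of K s \<longleftrightarrow> (s ''bl'' 0 = 0 \<longrightarrow> K = {}) \<and>
    (s ''bl'' 0 \<noteq> 0 \<longrightarrow> (s ''bv'' 0, s ''bl'' 0) \<in> K \<and>
      s ''bp'' 0 = path_total (s ''P'') (s ''next'') (s ''bv'' 0) (s ''bl'' 0) \<and>
      s ''bw'' 0 = path_total (s ''W'') (s ''next'') (s ''bv'' 0) (s ''bl'' 0) \<and>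
      (\<forall>(v, l)\<in>K. path_total (s ''W'') (s ''next'') v l * s ''bp'' 0 \<le> s ''bw'' 0 * path_total (s ''P'') (s ''next'') v l))"

definition instance_vars :: "string set" where
  "instance_vars = {''P'', ''W'', ''next'', ''free'', ''done''}"

lemma best_of_cong:
  assumes "\<forall>x\<in>instance_vars \<union> {''bl'', ''bv'', ''bp'', ''bw''}. s x = s' x"
  shows "best_of K s \<longleftrightarrow> best_of K s'"
  using assms by (simp add: best_of_def instance_vars_def)

text \<open>Comparing densities by cross multiplication is not transitive in the presence of
  \<open>0 / 0\<close>. The scan is sound nevertheless: a path with total processing time 0 is never
  replaced, and it costs nothing to prefer it to any other.\<close>

lemma better_trans:
  fixes a b c d e f :: nat
  assumes "e * b \<le> a * f" "a * d < c * b"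
  shows "e * d \<le> c * f"
proof -
  have "0 < b" using assms(2) by (cases b) auto
  have "(e * d) * b = (e * b) * d" by simp
  also have "\<dots> \<le> (a * f) * d" using assms(1) by (rule mult_right_mono) simp
  also have "\<dots> = (a * d) * f" by simp
  also have "\<dots> \<le> (c * b) * f" using assms(2) by (intro mult_right_mono) auto
  finally have "(e * d) * b \<le> (c * f) * b" by (simp add: ac_simps)
  then show ?thesis using \<open>0 < b\<close> by simp
qed

lemma run_consider_path:
  assumes "best_of K s" "s ''v'' 0 = v" "s ''l'' 0 = l"
    "s ''sp'' 0 = path_total (s ''P'') (s ''next'') v (Suc l)"
    "s ''sw'' 0 = path_total (s ''W'') (s ''next'') v (Suc l)"
  shows "best_of (insert (v, Suc l) K) (run n consider_path s)"
proof -
  let ?t = "\<lambda>f. path_total (s f) (s ''next'')"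
  show ?thesis
  proof (cases "s ''bl'' 0 = 0 \<or> s ''bw'' 0 * s ''sp'' 0 < s ''sw'' 0 * s ''bp'' 0")
    case True
    have "?t ''W'' v' l' * s ''sp'' 0 \<le> s ''sw'' 0 * ?t ''P'' v' l'" if "(v', l') \<in> K" for v' l'
    proof -
      have nz: "s ''bl'' 0 \<noteq> 0"
      proof
        assume "s ''bl'' 0 = 0"
        then have "K = {}" using assms(1) by (simp add: best_of_def)
        then show False using that by simp
      qed
      have "\<forall>(v, l)\<in>K. ?t ''W'' v l * s ''bp'' 0 \<le> s ''bw'' 0 * ?t ''P'' v l"
        using mp[OF conjunct2[OF assms(1)[unfolded best_of_def]] nz] by (elim conjE)
      from bspec[OF this that] have "?t ''W'' v' l' * s ''bp'' 0 \<le> s ''bw'' 0 * ?t ''P'' v' l'" by simp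
      moreover have "s ''bw'' 0 * s ''sp'' 0 < s ''sw'' 0 * s ''bp'' 0" using True nz by simp
      ultimately show ?thesis by (rule better_trans)
    qed
    moreover have "run n consider_path s = store ''bw'' 0 (s ''sw'' 0) (store ''bp'' 0 (s ''sp'' 0)
        (store ''bl'' 0 (Suc l) (store ''bv'' 0 v s)))"
      using True assms(2,3) by (auto simp: consider_path_def store_other)
    ultimately show ?thesis using assms(4,5)
      unfolding best_of_def by (simp add: store_other) auto
  next
    case False
    then have "run n consider_path s = s" by (simp add: consider_path_def)
    moreover have "?t ''W'' v (Suc l) * s ''bp'' 0 \<le> s ''bw'' 0 * ?t ''P'' v (Suc l)"
      using False assms(4,5) by simp
    ultimately show ?thesis using assms(1) False unfolding best_of_def by simp (elim conjE, simp)
  qed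
qed

text \<open>The pairs scanned so far in lexicographic order; stage \<open>(v, n)\<close> coincides
  with stage \<open>(Suc v, 0)\<close> because candidates have positive length.\<close>

definition considered :: "nat \<Rightarrow> memory \<Rightarrow> nat \<Rightarrow> nat \<Rightarrow> (nat \<times> nat) set" where
  "considered n s v l = {(v', l'). candidate s v' l' \<and> (v' < v \<and> l' \<le> n \<or> v' = v \<and> l' \<le> l)}"

lemma run_extend_path:
  assumes "s0 ''free'' v \<noteq> 0" "best_of (considered n s0 v 0) s"
    and s: "\<forall>x\<in>instance_vars. s x = s0 x" "s ''v'' 0 = v" "s ''u'' 0 = v" "s ''sp'' 0 = 0" "s ''sw'' 0 = 0"
  shows "best_of (considered n s0 v n) (run n (For ''l'' extend_path) s)"
proof -
  define nxt where "nxt = s0 ''next''"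
  let ?open = "\<lambda>l. \<forall>i<l. s0 ''done'' ((nxt ^^ i) v) = 0"
  \<comment> \<open>Two phases: while the walk is open, \<open>u\<close>, \<open>sp\<close> and
    \<open>sw\<close> describe its first \<open>l\<close> jobs; afterwards \<open>u\<close> is stuck
    at a done job.\<close>
  let ?I = "\<lambda>l s. (\<forall>x\<in>instance_vars. s x = s0 x) \<and> s ''v'' 0 = v \<and> best_of (considered n s0 v l) s \<and>
    (if ?open l then s ''u'' 0 = (nxt ^^ l) v \<and> s ''sp'' 0 = path_total (s0 ''P'') nxt v l \<and>
        s ''sw'' 0 = path_total (s0 ''W'') nxt v l
     else s0 ''done'' (s ''u'' 0) \<noteq> 0)"
  have "?I n (run n (For ''l'' extend_path) s)"
  proof (rule run_For_invariant[where I = ?I])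
    show "''l'' \<notin> assigned extend_path" by (simp add: extend_path_def consider_path_def)
    have "best_of (considered n s0 v 0) (store ''l'' 0 0 s)"
      using assms(2) by (subst best_of_cong[of _ s]) (auto simp: store_def instance_vars_def)
    then show "?I 0 (store ''l'' 0 0 s)"
      using s by (auto simp: store_def path_total_def instance_vars_def)
  next
    fix l s1 assume l: "l < n" "s1 ''l'' 0 = l" "?I l s1"
    have iv: "s1 ''P'' = s0 ''P''" "s1 ''W'' = s0 ''W''" "s1 ''next'' = nxt" "s1 ''done'' = s0 ''done''"
      using l(3) by (auto simp: instance_vars_def nxt_def)
    show "?I (Suc l) (store ''l'' 0 (Suc l) (run n extend_path s1))"
    proof (cases "s0 ''done'' (s1 ''u'' 0) = 0")
      case False
      then have no: "\<not> ?open (Suc l)"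
      proof (cases "?open l")
        case True
        with l(3) have "s1 ''u'' 0 = (nxt ^^ l) v" by simp
        then show ?thesis using \<open>s0 ''done'' (s1 ''u'' 0) \<noteq> 0\<close> by (intro notI) (drule spec[of _ l], simp)
      next
        case False
        then obtain i where "i < l" "s0 ''done'' ((nxt ^^ i) v) \<noteq> 0" by blast
        then show ?thesis by (intro notI) (drule spec[of _ i], simp)
      qed
      then have "considered n s0 v (Suc l) = considered n s0 v l"
        by (auto simp: considered_def candidate_def nxt_def le_Suc_eq)
      moreover have "best_of (considered n s0 v l) (store ''l'' 0 (Suc l) s1)"
        using l(3) by (subst best_of_cong[of _ s1]) (auto simp: store_def instance_vars_def)
      moreover have "run n extend_path s1 = s1" using False iv by (simp add: extend_path_def)
      ultimately show ?thesis using l(3) no False by (auto simp: store_def instance_vars_def)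
    next
      case True
      then have op: "?open l" using l(3) by (auto split: if_splits)
      then have u: "s1 ''u'' 0 = (nxt ^^ l) v" "s1 ''sp'' 0 = path_total (s0 ''P'') nxt v l"
        "s1 ''sw'' 0 = path_total (s0 ''W'') nxt v l" using l(3) by auto
      then have op': "?open (Suc l)" using op True by (auto simp: less_Suc_eq)
      then have K: "considered n s0 v (Suc l) = insert (v, Suc l) (considered n s0 v l)"
        using assms(1) by (auto simp: considered_def candidate_def nxt_def le_Suc_eq)
      define s2 where "s2 = store ''sw'' 0 (path_total (s0 ''W'') nxt v (Suc l)) (store ''sp'' 0 (path_total (s0 ''P'') nxt v (Suc l)) s1)"
      have run: "run n extend_path s1 = store ''u'' 0 (nxt (s1 ''u'' 0)) (run n consider_path s2)"
        using True iv u by (simp add: extend_path_def s2_def store_other path_total_def run_frame consider_path_def)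
      have "best_of (considered n s0 v l) s2"
        using l(3) by (subst best_of_cong[of _ s1]) (auto simp: store_def instance_vars_def s2_def)
      then have "best_of (considered n s0 v (Suc l)) (run n consider_path s2)"
        unfolding K using l iv by (intro run_consider_path) (auto simp: s2_def store_def)
      then have "best_of (considered n s0 v (Suc l)) (store ''l'' 0 (Suc l) (run n extend_path s1))"
        unfolding run by (subst best_of_cong) (auto simp: store_def instance_vars_def)
      moreover have "x \<notin> {''bl'', ''bv'', ''bp'', ''bw''} \<Longrightarrow> run n consider_path s2 x = s2 x" for x
        by (intro run_frame) (simp add: consider_path_def)
      ultimately show ?thesis using l(3) op' u unfolding run
        by (auto simp: store_def instance_vars_def s2_def)
    qed
  qed
  then show ?thesis by blast
qed

lemma search_frame: "x \<in> instance_vars \<union> {''S_num'', ''S_den'', ''T'', ''n''} \<Longrightarrow> run n search s x = s x"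
  by (intro run_frame) (auto simp: search_def extend_path_def consider_path_def instance_vars_def)

lemma run_search: "best_of (considered n s n 0) (run n search s)"
proof -
  let ?I = "\<lambda>v s'. (\<forall>x\<in>instance_vars. s' x = s x) \<and> best_of (considered n s v 0) s'"
  let ?body = "When (Cell ''free'' (var ''v'')) (Put ''u'' (Num 0) (var ''v'') ;;
       Put ''sp'' (Num 0) (Num 0) ;; Put ''sw'' (Num 0) (Num 0) ;; For ''l'' extend_path)"
  have "?I n (run n (For ''v'' ?body) (store ''bl'' 0 0 s))"
  proof (rule run_For_invariant[where I = ?I])
    show "''v'' \<notin> assigned ?body" by (simp add: extend_path_def consider_path_def)
    have "considered n s 0 0 = {}" by (auto simp: considered_def candidate_def)
    then show "?I 0 (store ''v'' 0 0 (store ''bl'' 0 0 s))"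
      by (simp add: best_of_def store_def instance_vars_def)
  next
    fix v s1 assume v: "v < n" "s1 ''v'' 0 = v" "?I v s1"
    have free: "s1 ''free'' = s ''free''" using v(3) by (simp add: instance_vars_def)
    show "?I (Suc v) (store ''v'' 0 (Suc v) (run n ?body s1))"
    proof (cases "s ''free'' v = 0")
      case True
      then have "considered n s (Suc v) 0 = considered n s v 0"
        by (auto simp: considered_def candidate_def less_Suc_eq)
      moreover have "best_of (considered n s v 0) (store ''v'' 0 (Suc v) s1)"
        using v(3) by (subst best_of_cong[of _ s1]) (auto simp: store_def instance_vars_def)
      ultimately show ?thesis using v True free by (auto simp: store_def instance_vars_def)
    next
      case False
      define s2 where "s2 = store ''sw'' 0 0 (store ''sp'' 0 0 (store ''u'' 0 v s1))"
      have "best_of (considered n s v 0) s2"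
        using v(3) by (subst best_of_cong[of _ s1]) (auto simp: store_def instance_vars_def s2_def)
      then have "best_of (considered n s v n) (run n (For ''l'' extend_path) s2)"
        using v False by (intro run_extend_path) (auto simp: s2_def store_def instance_vars_def)
      moreover have "considered n s (Suc v) 0 = considered n s v n"
        by (auto simp: considered_def candidate_def less_Suc_eq)
      ultimately have "best_of (considered n s (Suc v) 0) (store ''v'' 0 (Suc v) (run n (For ''l'' extend_path) s2))"
        by (subst best_of_cong) (auto simp: store_def instance_vars_def)
      moreover have "run n (For ''l'' extend_path) s2 x = s x" if "x \<in> instance_vars" for x
      proof -
        have "run n (For ''l'' extend_path) s2 x = s2 x"
          using that by (intro run_frame) (auto simp: extend_path_def consider_path_def instance_vars_def)
        then show ?thesis using that v(3) by (auto simp: s2_def store_def instance_vars_def)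
      qed
      ultimately show ?thesis using False v free
        by (auto simp: s2_def store_def instance_vars_def)
    qed
  qed
  then show ?thesis by (simp add: search_def)
qed


section \<open>Correctness of the greedy program\<close>

text \<open>Times and weights may have different scales: a cross-multiplied comparison gains the
  same factor \<open>c * den\<close> on both sides. The time scale \<open>den\<close> is also the
  denominator of the output.\<close>

locale greedy_run = or_inforest "{..<n}" E p w nxt
  for n :: nat and E p w nxt +
  fixes P W :: "nat \<Rightarrow> nat" and den :: nat and c :: real
  assumes nxt_le: "i < n \<Longrightarrow> nxt i \<le> n"
    and P: "j < n \<Longrightarrow> real (P j) = p j * real den" and den_pos: "0 < den"
    and W: "j < n \<Longrightarrow> real (W j) = w j * c" and c_pos: "0 < c"
begin

definition finished :: "memory \<Rightarrow> nat set" where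
  "finished s = {j. j < n \<and> s ''done'' j \<noteq> 0}"

definition clock :: "memory \<Rightarrow> real" where
  "clock s = real (s ''T'' 0) / real den"

definition state :: "memory \<Rightarrow> bool" where
  "state s \<longleftrightarrow> s ''P'' = P \<and> s ''W'' = W \<and> s ''next'' = nxt \<and> (\<forall>j<n. s ''S_den'' j = den) \<and>
     s ''done'' n \<noteq> 0 \<and> (\<forall>j<n. s ''free'' j \<noteq> 0 \<longleftrightarrow> available (finished s) j) \<and>
     valid_partial (finished s) (decode s) (clock s)"

lemma state_cong:
  assumes "\<forall>x\<in>instance_vars \<union> {''S_num'', ''S_den'', ''T''}. s' x = s x"
  shows "state s' \<longleftrightarrow> state s" "finished s' = finished s" "clock s' = clock s" "decode s' = decode s"
proof -
  show f: "finished s' = finished s" and c: "clock s' = clock s" and d: "decode s' = decode s"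
    using assms by (auto simp: finished_def clock_def decode_def instance_vars_def)
  show "state s' \<longleftrightarrow> state s" using assms by (simp add: state_def f c d instance_vars_def)
qed

text \<open>A walk can leave the jobs only through the sentinel \<open>n\<close>, which is marked as
  done.\<close>

lemma open_path_less:
  assumes "s ''done'' n \<noteq> 0" "v < n" "\<forall>i<l. s ''done'' ((nxt ^^ i) v) = 0" "i < l"
  shows "(nxt ^^ i) v < n"
  using assms(4)
proof (induction i)
  case (Suc i)
  then have "(nxt ^^ Suc i) v \<le> n" using nxt_le by simp
  moreover have "(nxt ^^ Suc i) v \<noteq> n" using assms(1,3) Suc.prems by metis
  ultimately show ?case by simp
qed (simp add: assms)

lemma free_path_candidate:
  assumes "state s" "0 < l"
  shows "free_path (finished s) v l \<longleftrightarrow> v < n \<and> candidate s v l"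
proof
  assume f: "free_path (finished s) v l"
  then have *: "(nxt ^^ i) v \<in> {..<n} - finished s" if "i < l" for i
    using that unfolding free_path_def path_def by blast
  have "v < n" using *[of 0] assms(2) by simp
  moreover have "s ''done'' ((nxt ^^ i) v) = 0" if "i < l" for i
    using *[OF that] by (simp add: finished_def)
  ultimately show "v < n \<and> candidate s v l"
    using assms f by (simp add: candidate_def state_def free_path_def)
next
  assume v: "v < n \<and> candidate s v l"
  then have op: "\<forall>i<l. s ''done'' ((nxt ^^ i) v) = 0" using assms(1) by (simp add: candidate_def state_def)
  moreover have "(nxt ^^ i) v < n" if "i < l" for i
    using assms(1) v by (intro open_path_less[where l = l and s = s] op that) (auto simp: state_def)
  ultimately have "path v l \<subseteq> {..<n} - finished s" by (auto simp: path_def finished_def)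
  then show "free_path (finished s) v l"
    using assms(1) v unfolding free_path_def candidate_def state_def by (auto simp del: neq0_conv)
qed

lemma path_total_sum:
  assumes "path v l \<subseteq> {..<n}"
  shows "real (path_total P nxt v l) = sum p (path v l) * real den"
    "real (path_total W nxt v l) = sum w (path v l) * c"
proof -
  have "(nxt ^^ i) v < n" if "i < l" for i using assms that by (auto simp: path_def)
  then show "real (path_total P nxt v l) = sum p (path v l) * real den"
    "real (path_total W nxt v l) = sum w (path v l) * c"
    unfolding sum_path[OF assms] path_total_def by (simp_all add: P W sum_distrib_right)
qed

lemma path_Suc: "path v (Suc l) = insert ((nxt ^^ l) v) (path v l)"
  by (auto simp: path_def lessThan_Suc)

lemma schedule_job:
  assumes "state s" "u < n" "u \<notin> finished s" "available (finished s) u"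
  defines "s' \<equiv> store ''free'' (nxt u) 1 (store ''done'' u 1
    (store ''T'' 0 (s ''T'' 0 + P u) (store ''S_num'' u (s ''T'' 0) s)))"
  shows "state s'" "finished s' = insert u (finished s)" "clock s' = clock s + p u"
    "decode s' = (decode s)(u := clock s)"
proof -
  show f: "finished s' = insert u (finished s)"
    using assms(2) by (auto simp: finished_def s'_def store_def)
  show c: "clock s' = clock s + p u"
    using P[OF assms(2)] den_pos by (simp add: clock_def s'_def store_def add_divide_distrib)
  show d: "decode s' = (decode s)(u := clock s)"
    using assms(1,2) by (auto simp: decode_def clock_def state_def s'_def store_def)
  have "valid_partial (finished s') (decode s') (clock s')"
    unfolding f c d using assms by (intro valid_partial_insert) (auto simp: state_def)
  moreover have "s' ''free'' j \<noteq> 0 \<longleftrightarrow> available (finished s') j" if "j < n" for j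
  proof -
    \<comment> \<open>Finishing \<open>u\<close> can make only its successor available, which is the
      one entry of \<open>free\<close> that is set.\<close>
    have "(u, j) \<in> E \<longleftrightarrow> nxt u = j" using edge_iff[of u j] assms(2) that by auto
    then have "available (finished s') j \<longleftrightarrow> available (finished s) j \<or> nxt u = j"
      unfolding f available_def by blast
    moreover have "s' ''free'' j \<noteq> 0 \<longleftrightarrow> s ''free'' j \<noteq> 0 \<or> nxt u = j"
      by (auto simp: s'_def store_def)
    ultimately show ?thesis using assms(1) that by (simp add: state_def)
  qed
  ultimately show "state s'"
    using assms(1) by (simp add: state_def s'_def store_def)
qed

lemma run_schedule_path:
  assumes "state s" and bl: "s ''bl'' 0 = bl" "s ''bv'' 0 = bv" "bl \<le> n"
    "0 < bl \<Longrightarrow> free_path (finished s) bv bl"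
  defines "s' \<equiv> run n schedule_path s"
  shows "state s'" "finished s' = finished s \<union> path bv bl"
    "clock s' = clock s + sum p (path bv bl)" "\<forall>j\<in>finished s. decode s' j = decode s j"
proof -
  let ?body = "When (Sub (var ''bl'') (var ''l'')) (
       Put ''S_num'' (var ''u'') (var ''T'') ;;
       Put ''T'' (Num 0) (Add (var ''T'') (Cell ''P'' (var ''u''))) ;;
       Put ''done'' (var ''u'') (Num 1) ;;
       Put ''free'' (Cell ''next'' (var ''u'')) (Num 1) ;;
       Put ''u'' (Num 0) (Cell ''next'' (var ''u'')))"
  \<comment> \<open>The loop idles after \<open>bl\<close> of its \<open>n\<close> iterations, hence
    \<open>min k bl\<close>.\<close>
  let ?I = "\<lambda>k s'. s' ''bl'' 0 = bl \<and> state s' \<and> (k \<le> bl \<longrightarrow> s' ''u'' 0 = (nxt ^^ k) bv) \<and>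
    finished s' = finished s \<union> path bv (min k bl) \<and>
    clock s' = clock s + sum p (path bv (min k bl)) \<and> (\<forall>j\<in>finished s. decode s' j = decode s j)"
  have "?I n (run n (For ''l'' ?body) (store ''u'' 0 bv s))"
  proof (rule run_For_invariant[where I = ?I])
    have "state (store ''l'' 0 0 (store ''u'' 0 bv s)) \<longleftrightarrow> state s"
      "finished (store ''l'' 0 0 (store ''u'' 0 bv s)) = finished s"
      "clock (store ''l'' 0 0 (store ''u'' 0 bv s)) = clock s"
      "decode (store ''l'' 0 0 (store ''u'' 0 bv s)) = decode s"
      by (rule state_cong; simp add: store_def instance_vars_def)+
    then show "?I 0 (store ''l'' 0 0 (store ''u'' 0 bv s))"
      using assms(1) bl by (simp add: path_def) (simp add: store_def)
  next
    fix k s1 assume k: "k < n" "s1 ''l'' 0 = k" "?I k s1"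
    show "?I (Suc k) (store ''l'' 0 (Suc k) (run n ?body s1))"
    proof (cases "k < bl")
      case False
      have "state (store ''l'' 0 (Suc k) s1) \<longleftrightarrow> state s1"
        "finished (store ''l'' 0 (Suc k) s1) = finished s1"
        "clock (store ''l'' 0 (Suc k) s1) = clock s1"
        "decode (store ''l'' 0 (Suc k) s1) = decode s1"
        by (rule state_cong; simp add: store_def instance_vars_def)+
      moreover have "run n ?body s1 = s1" using False k by simp
      moreover have "min (Suc k) bl = min k bl" using False by simp
      ultimately show ?thesis using k(3) False by (simp add: store_other)
    next
      case True
      define u where "u = (nxt ^^ k) bv"
      have fp: "free_path (finished s) bv bl" using True bl(4) by simp
      then have pV: "path bv bl \<subseteq> {..<n}" by (auto simp: free_path_def)
      have u: "u \<in> path bv bl" using True by (auto simp: u_def path_def)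
      have un: "u < n" "u \<notin> finished s" using u fp unfolding free_path_def by auto
      have new: "u \<notin> path bv k"
      proof
        assume "u \<in> path bv k"
        then obtain i where "i < k" "(nxt ^^ k) bv = (nxt ^^ i) bv" by (auto simp: path_def u_def)
        then show False using inj_onD[OF path_inj[OF pV], of k i] True by simp
      qed
      have s1: "state s1" "s1 ''u'' 0 = u" "finished s1 = finished s \<union> path bv k"
        "clock s1 = clock s + sum p (path bv k)" "\<forall>j\<in>finished s. decode s1 j = decode s j"
        "s1 ''bl'' 0 = bl"
        using k(3) True by (simp_all add: u_def min_def)
      have av: "available (finished s1) u"
      proof (cases k)
        case 0
        then show ?thesis using fp s1(3) by (auto simp: free_path_def u_def path_def)
      next
        case (Suc k')
        define u' where "u' = (nxt ^^ k') bv"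
        have "u' \<in> path bv k" using Suc by (auto simp: path_def u'_def)
        moreover have "u' \<in> path bv bl" using Suc True by (auto simp: path_def u'_def)
        then have "(u', u) \<in> E" using pV un(1) edge_iff[of u' u] Suc by (auto simp: u_def u'_def)
        ultimately show ?thesis unfolding available_def s1(3) by blast
      qed
      define s2 where "s2 = store ''free'' (nxt u) 1 (store ''done'' u 1
        (store ''T'' 0 (s1 ''T'' 0 + P u) (store ''S_num'' u (s1 ''T'' 0) s1)))"
      have "u \<notin> finished s1" using un new s1(3) by simp
      note s2 = schedule_job[OF s1(1) un(1) this av, folded s2_def]
      have iv: "s1 ''P'' = P" "s1 ''next'' = nxt" using s1(1) by (auto simp: state_def)
      have run: "run n ?body s1 = store ''u'' 0 (nxt u) s2"
        using True k(2) s1 iv by (simp add: store_other s2_def)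
      define s3 where "s3 = store ''l'' 0 (Suc k) (store ''u'' 0 (nxt u) s2)"
      have s3: "state s3 \<longleftrightarrow> state s2" "finished s3 = finished s2" "clock s3 = clock s2" "decode s3 = decode s2"
        by (rule state_cong; simp add: store_def instance_vars_def s3_def)+
      have "s3 ''bl'' 0 = bl" "s3 ''u'' 0 = nxt u" using s1 by (simp_all add: s3_def s2_def store_def)
      moreover have "sum p (path bv (Suc k)) = p u + sum p (path bv k)"
        unfolding path_Suc using new by (subst sum.insert) (auto simp: u_def path_def)
      moreover have "\<forall>j\<in>finished s. decode s3 j = decode s j"
        using s1(5) un(2) by (auto simp: s3 s2)
      moreover have "min (Suc k) bl = Suc k" using True by simp
      ultimately have "?I (Suc k) s3"
        using s1 by (simp add: s3 s2) (simp add: u_def path_Suc)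
      then show ?thesis unfolding run s3_def[symmetric] .
    qed
  qed simp
  moreover have "s' = run n (For ''l'' ?body) (store ''u'' 0 bv s)"
    using bl by (simp add: s'_def schedule_path_def)
  ultimately show "state s'" "finished s' = finished s \<union> path bv bl"
    "clock s' = clock s + sum p (path bv bl)" "\<forall>j\<in>finished s. decode s' j = decode s j"
    using bl(3) by (simp_all add: min_def)
qed

text \<open>Progress holds because a minimal unscheduled job is available and forms a free path of
  length 1, so the search cannot come back empty. Once all jobs are finished, a round schedules the
  empty path.\<close>

lemma round:
  assumes "state s" "charged (finished s) (decode s) (clock s)"
  defines "s' \<equiv> run n (search ;; schedule_path) s"
  shows "state s'" "charged (finished s') (decode s') (clock s')"
    "card (finished s) < card (finished s') \<or> finished s' = {..<n}"
proof -
  let ?V = "{..<n}"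
  define s1 where "s1 = run n search s"
  define bl bv where "bl = s1 ''bl'' 0" and "bv = s1 ''bv'' 0"
  have frame: "\<forall>x\<in>instance_vars \<union> {''S_num'', ''S_den'', ''T''}. s1 x = s x"
    unfolding s1_def by (intro ballI search_frame) auto
  note s1 = state_cong[OF frame]
  have data: "s1 ''P'' = P" "s1 ''W'' = W" "s1 ''next'' = nxt"
    using frame assms(1) by (auto simp: state_def instance_vars_def)
  have DV: "finished s \<subseteq> ?V" by (auto simp: finished_def)
  have best: "best_of (considered n s n 0) s1" unfolding s1_def by (rule run_search)
  \<comment> \<open>A path of distinct jobs has at most \<open>n\<close> of them, so scanning
    lengths up to \<open>n\<close> misses none.\<close>
  have considered: "(v, l) \<in> considered n s n 0 \<longleftrightarrow> free_path (finished s) v l" if "0 < l" for v l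
  proof
    assume "(v, l) \<in> considered n s n 0"
    then show "free_path (finished s) v l"
      using free_path_candidate[OF assms(1) that] that by (auto simp: considered_def)
  next
    assume f: "free_path (finished s) v l"
    then have "l \<le> n" using path_length[of v l] by (auto simp: free_path_def)
    then show "(v, l) \<in> considered n s n 0"
      using f free_path_candidate[OF assms(1) that] by (auto simp: considered_def)
  qed
  have nonempty: "bl = 0 \<Longrightarrow> considered n s n 0 = {}"
    using best by (simp add: best_of_def bl_def)
  have chosen: "free_path (finished s) bv bl" "bl \<le> n"
    "\<And>v l. free_path (finished s) v l \<Longrightarrow> 0 < l \<Longrightarrow>
      sum w (path v l) * sum p (path bv bl) \<le> sum w (path bv bl) * sum p (path v l)" if "0 < bl"
  proof -
    have b: "(bv, bl) \<in> considered n s n 0" "s1 ''bp'' 0 = path_total P nxt bv bl"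
      "s1 ''bw'' 0 = path_total W nxt bv bl"
      and max: "\<forall>(v, l)\<in>considered n s n 0.
        path_total W nxt v l * s1 ''bp'' 0 \<le> s1 ''bw'' 0 * path_total P nxt v l"
      using best that by (simp_all add: best_of_def bl_def bv_def data) (elim conjE, simp)
    show fb: "free_path (finished s) bv bl" using b(1) considered[OF that] by simp
    show "bl \<le> n" using fb path_length[of bv bl] by (auto simp: free_path_def)
    fix v l assume f: "free_path (finished s) v l" "0 < l"
    have "path_total W nxt v l * path_total P nxt bv bl \<le> path_total W nxt bv bl * path_total P nxt v l"
      using bspec[OF max, of "(v, l)"] considered[OF f(2)] f(1) b(2,3) by simp
    then have "real (path_total W nxt v l) * real (path_total P nxt bv bl)
        \<le> real (path_total W nxt bv bl) * real (path_total P nxt v l)"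
      by (metis of_nat_le_iff of_nat_mult)
    moreover have "path v l \<subseteq> ?V" "path bv bl \<subseteq> ?V" using f fb by (auto simp: free_path_def)
    ultimately have "(sum w (path v l) * sum p (path bv bl)) * (c * real den)
        \<le> (sum w (path bv bl) * sum p (path v l)) * (c * real den)"
      by (simp add: path_total_sum ac_simps)
    moreover have "0 < c * real den" using c_pos den_pos by simp
    ultimately show "sum w (path v l) * sum p (path bv bl) \<le> sum w (path bv bl) * sum p (path v l)"
      by (rule mult_right_le_imp_le)
  qed
  have "bl \<le> n" using chosen(2) by (cases "bl = 0") auto
  note sp = run_schedule_path[of s1 bl bv, OF _ bl_def[symmetric] bv_def[symmetric] this,
      unfolded s1, OF assms(1) chosen(1)]
  have s': "s' = run n schedule_path s1" by (simp add: s'_def s1_def)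
  show st: "state s'" unfolding s' by (rule sp)
  have fin: "finished s' = finished s \<union> path bv bl"
    and clock: "clock s' = clock s + sum p (path bv bl)"
    and dec: "\<forall>j\<in>finished s. decode s' j = decode s j"
    unfolding s' by (rule sp; simp)+
  have sub: "path bv bl \<subseteq> ?V - finished s"
    using chosen(1) by (cases "bl = 0") (auto simp: free_path_def path_def)
  show "charged (finished s') (decode s') (clock s')"
    unfolding fin clock
  proof (rule charged_step[OF assms(2) DV sub _ dec])
    \<comment> \<open>If the search found nothing, there is no free path of positive length and the
      claim is vacuous.\<close>
    show "sum w (path v l) * sum p (path bv bl) \<le> sum w (path bv bl) * sum p (path v l)"
      if "free_path (finished s) v l" "0 < l" for v l
      using chosen(3)[OF _ that] nonempty considered[OF that(2), of v] that(1) by blast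
    show "\<forall>j\<in>path bv bl. decode s' j + p j \<le> clock s + sum p (path bv bl)"
      using st unfolding state_def valid_partial_def clock[symmetric] fin by blast
  qed
  show "card (finished s) < card (finished s') \<or> finished s' = ?V"
  proof (cases "finished s = ?V")
    case True
    then show ?thesis using fin sub by auto
  next
    case False
    then obtain v where v: "v \<in> ?V - finished s" "\<And>i. (i, v) \<in> E \<Longrightarrow> i \<notin> ?V - finished s"
      using minimal_element[of "?V - finished s"] DV by blast
    have "available (finished s) v"
      using v(2) E_sub unfolding available_def by blast
    then have "free_path (finished s) v 1" using v(1) by (auto simp: free_path_def path_def)
    then have "0 < bl" using considered[of 1 v] nonempty by auto
    then have "bv \<in> path bv bl" by (auto simp: path_def intro: image_eqI[of _ _ 0])
    then have "bv \<in> finished s'" "bv \<notin> finished s" using fin sub by auto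
    then have "finished s \<subset> finished s'" using fin by auto
    moreover have "finite (finished s')" by (simp add: finished_def)
    ultimately show ?thesis by (simp add: psubset_card_mono)
  qed
qed

lemma run_rounds:
  assumes "state s" "finished s = {}" "clock s = 0"
  defines "s' \<equiv> run n (For ''r'' (search ;; schedule_path)) s"
  shows "state s'" "finished s' = {..<n}" "charged {..<n} (decode s') (clock s')"
proof -
  let ?I = "\<lambda>k s. state s \<and> charged (finished s) (decode s) (clock s) \<and>
    (k \<le> card (finished s) \<or> finished s = {..<n})"
  have cong: "?I k (store ''r'' 0 v s) \<longleftrightarrow> ?I k s" for k v s
  proof -
    have "state (store ''r'' 0 v s) \<longleftrightarrow> state s" "finished (store ''r'' 0 v s) = finished s"
      "clock (store ''r'' 0 v s) = clock s" "decode (store ''r'' 0 v s) = decode s"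
      by (rule state_cong; simp add: store_def instance_vars_def)+
    then show ?thesis by simp
  qed
  have I: "?I n s'"
    unfolding s'_def
  proof (rule run_For_invariant[where I = ?I])
    show "''r'' \<notin> assigned (search ;; schedule_path)"
      by (simp add: search_def schedule_path_def extend_path_def consider_path_def)
    show "?I 0 (store ''r'' 0 0 s)" unfolding cong using assms charged_empty by simp
  next
    fix k s1 assume "k < n" and s1: "?I k s1"
    then have st: "state s1" "charged (finished s1) (decode s1) (clock s1)" by blast+
    note r = round[OF st]
    let ?s2 = "run n (search ;; schedule_path) s1"
    have "card (finished ?s2) \<le> card {..<n}" by (rule card_mono) (auto simp: finished_def)
    moreover have "k \<le> card (finished s1) \<or> card (finished s1) = n"
      using conjunct2[OF conjunct2[OF s1]] by (elim disjE) simp_all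
    moreover have "k < n" by fact
    ultimately have "Suc k \<le> card (finished ?s2) \<or> finished ?s2 = {..<n}"
      using r(3) by (elim disjE) simp_all
    then show "?I (Suc k) (store ''r'' 0 (Suc k) (run n (search ;; schedule_path) s1))"
      unfolding cong using r(1,2) by blast
  qed
  have "finished s' = {..<n}"
  proof (cases "n \<le> card (finished s')")
    case True
    then show ?thesis by (intro card_seteq) (auto simp: finished_def)
  next
    case False
    then show ?thesis using I by blast
  qed
  then show "state s'" "finished s' = {..<n}" "charged {..<n} (decode s') (clock s')" using I by auto
qed

end

section \<open>Encoded instances and the final bounds\<close>

lemma of_rat_fraction:
  assumes "0 \<le> r"
  shows "of_rat r = real (numerator r) / real (denominator r)" "0 < denominator r"
proof -
  obtain a b where ab: "quotient_of r = (a, b)" by force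
  have b: "0 < b" using quotient_of_denom_pos[OF ab] .
  have r: "r = of_int a / of_int b" using quotient_of_div[OF ab] .
  then have a: "0 \<le> a" using assms b by (simp add: zero_le_divide_iff)
  show "0 < denominator r" using b ab by (simp add: denominator_def)
  show "of_rat r = real (numerator r) / real (denominator r)"
    using a b ab by (simp add: r numerator_def denominator_def of_rat_divide)
qed

lemma less_power_bits: "x < 2 ^ bits x"
proof -
  have "x < 2 ^ floorlog 2 x" by (cases "x = 0") (auto simp: floorlog_bounds)
  also have "\<dots> \<le> 2 ^ bits x" by (simp add: bits_def)
  finally show ?thesis .
qed

text \<open>With these bounds the input size can play the roles of both \<open>L\<close> and
  \<open>B\<close> in \<open>compile_time\<close> and can replace the number of jobs in
  polynomials.\<close>

lemma encode_bounds:
  shows "encode I x i < 2 ^ input_size I" "njobs I \<le> input_size I" "0 < input_size I"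
proof -
  let ?f = "\<lambda>j. bits (numerator (ptime I j)) + bits (denominator (ptime I j)) +
                  bits (numerator (weight I j)) + bits (denominator (weight I j))"
  let ?g = "\<lambda>k. bits (adjacency I k)"
  have size: "input_size I = bits (njobs I) + sum ?f {..<njobs I} + sum ?g {..<njobs I * njobs I}"
    by (simp add: input_size_def)
  show "0 < input_size I" by (simp add: size bits_def)
  have f: "?f j \<le> input_size I" if "j < njobs I" for j
    using member_le_sum[of j "{..<njobs I}" ?f] that by (simp add: size)
  have g: "?g k \<le> input_size I" if "k < njobs I * njobs I" for k
    using member_le_sum[of k "{..<njobs I * njobs I}" ?g] that by (simp add: size)
  have "(\<Sum>j<njobs I. 1) \<le> sum ?f {..<njobs I}" by (intro sum_mono) (simp add: bits_def)
  then show "njobs I \<le> input_size I" by (simp add: size)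
  have less: "y < 2 ^ input_size I" if "bits y \<le> input_size I" for y
    by (rule less_le_trans[OF less_power_bits power_increasing[OF that]]) simp
  show "encode I x i < 2 ^ input_size I"
  proof (rule less)
    have "bits 0 = 1" by (simp add: bits_def floorlog_def)
    then have "bits 0 \<le> input_size I" "bits (njobs I) \<le> input_size I"
      using \<open>0 < input_size I\<close> by (linarith, simp add: size)
    moreover have "bits (numerator (ptime I i)) \<le> input_size I" "bits (denominator (ptime I i)) \<le> input_size I"
      "bits (numerator (weight I i)) \<le> input_size I" "bits (denominator (weight I i)) \<le> input_size I"
      if "i < njobs I" using f[OF that] by linarith+
    ultimately show "bits (encode I x i) \<le> input_size I"
      using g by (simp add: encode_def)
  qed
qed

lemma greedy_correct:
  assumes "valid_instance I" "inforest (jobs I) (prec I)"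
  defines "s' \<equiv> run (njobs I) greedy (encode I)"
  shows "wf_output I s'" "feasible (jobs I) (prec I) (rptime I) (decode s')"
    "feasible (jobs I) (prec I) (rptime I) S \<Longrightarrow>
      objective (jobs I) (rptime I) (rweight I) (decode s') \<le> 4 * objective (jobs I) (rptime I) (rweight I) S"
proof -
  define n where "n = njobs I"
  define s1 where "s1 = run n prepare_numbers (encode I)"
  define s2 where "s2 = run n prepare_graph s1"
  have V: "jobs I = {..<n}" by (simp add: jobs_def n_def)
  have E: "prec I \<subseteq> {..<n} \<times> {..<n}" "acyclic (prec I)"
    and nonneg: "\<And>j. j < n \<Longrightarrow> 0 \<le> ptime I j \<and> 0 \<le> weight I j"
    using assms(1) by (auto simp: valid_instance_def dag_def V)
  have sv: "single_valued (prec I)" using assms(2) by (rule inforest_single_valued)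
  have frame1: "s1 x = encode I x" if "x \<in> {''adj'', ''n'', ''done'', ''T''}" for x
    unfolding s1_def using that by (intro run_frame) (auto simp: prepare_numbers_def)
  have frame2: "s2 x = s1 x" if "x \<in> {''P'', ''W'', ''S_den'', ''T''}" for x
    unfolding s2_def using that by (intro run_frame) (auto simp: prepare_graph_def)
  have adj: "s1 ''adj'' (i * n + j) \<noteq> 0 \<longleftrightarrow> (i, j) \<in> prec I" if "i < n" "j < n" for i j
  proof -
    have "i * n + j < n * n"
    proof -
      have "i * n + j < Suc i * n" using that by simp
      also have "\<dots> \<le> n * n" using that by (intro mult_right_mono) auto
      finally show ?thesis .
    qed
    then show ?thesis using that
      by (simp add: frame1 encode_def adjacency_def n_def[symmetric])
  qed
  have "s1 ''n'' 0 = n" "\<forall>i. s1 ''done'' i = 0"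
    using frame1 by (simp_all add: encode_def n_def)
  note graph = run_prepare_graph[OF this, folded s2_def]
  have next1: "(i, s2 ''next'' i) \<in> prec I \<and> s2 ''next'' i < n \<or> (\<forall>j. (i, j) \<notin> prec I) \<and> s2 ''next'' i = n"
    if "i < n" for i
    using graph(1)[OF that] adj[OF that] E(1) by blast
  define den where "den = prod (encode I ''p_den'') {..<n}"
  define wden where "wden = prod (encode I ''w_den'') {..<n}"
  have enc: "encode I ''p_den'' j = denominator (ptime I j)" "encode I ''w_den'' j = denominator (weight I j)"
    "encode I ''p_num'' j = numerator (ptime I j)" "encode I ''w_num'' j = numerator (weight I j)"
    if "j < n" for j using that by (simp_all add: encode_def n_def)
  have pos: "0 < den" "0 < wden"
    unfolding den_def wden_def using enc nonneg of_rat_fraction(2) by (auto intro!: prod_pos)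
  have scale: "real (num * others_product d j n) = of_rat r * real (prod d {..<n})"
    if "j < n" "0 \<le> r" "num = numerator r" "d j = denominator r" for j num d r
    using of_rat_fraction[OF that(2)] others_product[OF that(1), of d, symmetric] that(3,4) by simp
  interpret greedy_run n "prec I" "rptime I" "rweight I" "s2 ''next''" "s2 ''P''" "s2 ''W''" den "real wden"
  proof unfold_locales
    \<comment> \<open>The inforest hypothesis enters here: the stored successor of \<open>i\<close>
      is its only one.\<close>
    show "(i, j) \<in> prec I \<longleftrightarrow> s2 ''next'' i = j \<and> j \<in> {..<n}" if "i \<in> {..<n}" for i j
      using next1[of i] that single_valuedD[OF sv] E(1) by auto
    show "s2 ''next'' i \<le> n" if "i < n" for i using next1[OF that] by auto
    show "real (s2 ''P'' j) = rptime I j * real den" "real (s2 ''W'' j) = rweight I j * real wden" if "j < n" for j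
      using run_prepare_numbers[OF that, of "encode I", folded s1_def] scale[OF that] nonneg[OF that] enc[OF that]
      by (simp_all add: frame2 den_def wden_def)
  qed (use E nonneg pos in auto)
  have fin: "finished s2 = {}" by (auto simp: finished_def graph(3))
  have clk: "clock s2 = 0" using frame1 frame2 by (simp add: clock_def encode_def)
  have "state s2"
    unfolding state_def fin clk
  proof (intro conjI allI impI)
    show "s2 ''S_den'' j = den" if "j < n" for j
      using run_prepare_numbers(3)[OF that, of "encode I", folded s1_def] by (simp add: frame2 den_def)
    show "s2 ''free'' j \<noteq> 0 \<longleftrightarrow> available {} j" if "j < n" for j
      using graph(2)[OF that] adj[OF _ that] E(1) by (auto simp: available_def)
  qed (auto simp: graph(3) valid_partial_def)
  note final = run_rounds[OF this fin clk]
  have s': "s' = run n (For ''r'' (search ;; schedule_path)) s2"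
    by (simp add: s'_def greedy_def s2_def s1_def n_def)
  show "wf_output I s'"
    using final(1) den_pos unfolding s' by (simp add: wf_output_def V state_def)
  show "feasible (jobs I) (prec I) (rptime I) (decode s')"
    using final(1,2) unfolding s' V state_def by (metis valid_partial_feasible)
  show "objective (jobs I) (rptime I) (rweight I) (decode s') \<le> 4 * objective (jobs I) (rptime I) (rweight I) S"
    if "feasible (jobs I) (prec I) (rptime I) S"
    using charged_objective[OF final(3)] that unfolding s' V by blast
qed

theorem theorem3:
  shows "\<exists>c. poly_time_approx_algorithm 4 {I. valid_instance I \<and> inforest (jobs I) (prec I)} c"
proof -
  define g where "g = steps greedy"
  \<comment> \<open>The bound of \<open>compile_time\<close> with the input size for
    \<open>L\<close>, \<open>B\<close> and the number of jobs; the last factor is then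
    \<open>Suc M\<close>.\<close>
  define q where "q = g * [:step_cost greedy:] * (1 + [:0, 1:] + [:0, 1:] * g)"
  have "\<exists>t s. exec (compile greedy) (encode I) t s \<and> t \<le> poly q (input_size I) \<and> wf_output I s \<and>
        feasible (jobs I) (prec I) (rptime I) (decode s) \<and>
        objective (jobs I) (rptime I) (rweight I) (decode s)
          \<le> 4 * optimum (jobs I) (prec I) (rptime I) (rweight I)"
    if I: "valid_instance I" "inforest (jobs I) (prec I)" for I
  proof -
    let ?N = "input_size I" and ?n = "njobs I"
    let ?s = "run ?n greedy (encode I)"
    note correct = greedy_correct[OF I]
    let ?M = "?N + ?N * poly g ?n"
    have "exec_le (compile greedy) (encode I) (poly g ?n * step_cost greedy * Suc ?M) ?s"
      using compile_time[OF well_formed_greedy, of "encode I" ?n ?N ?N ?M] encode_bounds[where I = I]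
      by (simp add: cells_below_def g_def) (simp add: encode_def)
    then obtain t where t: "exec (compile greedy) (encode I) t ?s" "t \<le> poly g ?n * step_cost greedy * Suc ?M"
      by (auto simp: exec_le_def)
    have "poly g ?n \<le> poly g ?N" using encode_bounds(2) by (rule poly_nat_mono)
    then have "poly g ?n * step_cost greedy * Suc ?M \<le> poly g ?N * step_cost greedy * Suc (?N + ?N * poly g ?N)"
      by (intro mult_le_mono) auto
    also have "\<dots> = poly q ?N" by (simp add: q_def algebra_simps)
    finally have "t \<le> poly q ?N" using t(2) by simp
    \<comment> \<open>The optimum is an infimum, so a quarter of the cost is shown to be a lower
      bound for all feasible schedules; the computed schedule shows that there is one.\<close>
    moreover have "objective (jobs I) (rptime I) (rweight I) (decode ?s) / 4
        \<le> optimum (jobs I) (prec I) (rptime I) (rweight I)"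
      unfolding optimum_def using correct(2,3) by (intro cInf_greatest) (auto, force)
    ultimately show ?thesis using t(1) correct(1,2) by (intro exI[of _ t] exI[of _ ?s]) auto
  qed
  then show ?thesis unfolding poly_time_approx_algorithm_def by blast
qed

end
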